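(* (i) For every $d\ge 1$ and every $C_0>0$ there is a finite constant $C=C(d,C_0)$ such that the following holds. Let $(A_Q)_{Q\in\mathcal D(Q_0)}$ be a sequence of positive semidefinite $d\times d$ matrices and $W$ a $d\times d$ matrix weight on $Q_0$. If $$\frac{1}{|K|}\sum_{Q\in\mathcal D(K)}A_Q\le C_0\,\mathbf 1\qquad\text{for all }K\in\mathcal D(Q_0)$$ (inequality in the sense of positive semidefinite matrices), then for all $f,g\in L^2_{\mathbb C^d}$ supported in $Q_0$ $$\sum_{Q\in\mathcal D(Q_0)}\bigl\|A_Q^{1/2}\langle W\rangle_Q^{-1}\langle W^{1/2}f\rangle_Q\bigr\|_{\mathbb C^d}\,\bigl\|A_Q^{1/2}\langle W^{-1}\rangle_Q^{-1}\langle W^{-1/2}g\rangle_Q\bigr\|_{\mathbb C^d}\le C\,[W]_{C_2}^{1/2}\,\|f\|_{L^2_{\mathbb C^d}}\|g\|_{L^2_{\mathbb C^d}}$$ (the inequality being void if $[W]_{C_2}=\infty$). (ii) (Necessity.) Let $W$ be a $d\times d$ matrix weight on $Q_0$. If there is a finite constant $C'$ such that $$\sum_{Q\in\mathcal D(Q_0)}\bigl\|A_Q^{1/2}\langle W\rangle_Q^{-1}\langle W^{1/2}f\rangle_Q\bigr\|_{\mathbb C^d}\,\bigl\|A_Q^{1/2}\langle W^{-1}\rangle_Q^{-1}\langle W^{-1/2}g\rangle_Q\bigr\|_{\mathbb C^d}\le C'\,\|f\|_{L^2_{\mathbb C^d}}\|g\|_{L^2_{\mathbb C^d}}$$ for all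 $f,g\in L^2_{\mathbb C^d}$ supported in $Q_0$ and all sequences $(A_Q)_{Q\in\mathcal D(Q_0)}$ of positive semidefinite $d\times d$ matrices with $\frac{1}{|K|}\sum_{Q\in\mathcal D(K)}A_Q\le\mathbf 1$ for all $K\in\mathcal D(Q_0)$, then $[W]_{C_2}<\infty$. (iii) (Optimality of the power.) Let $d\ge 2$. For no exponent $p<1/2$ does there exist a finite constant $C''$ such that $$\sum_{Q\in\mathcal D(Q_0)}\bigl\|A_Q^{1/2}\langle W\rangle_Q^{-1}\langle W^{1/2}f\rangle_Q\bigr\|_{\mathbb C^d}\,\bigl\|A_Q^{1/2}\langle W^{-1}\rangle_Q^{-1}\langle W^{-1/2}g\rangle_Q\bigr\|_{\mathbb C^d}\le C''\,[W]_{C_2}^{p}\,\|f\|_{L^2_{\mathbb C^d}}\|g\|_{L^2_{\mathbb C^d}}$$ for all $d\times d$ matrix weights $W$ on $Q_0$ with $[W]_{C_2}<\infty$, all $f,g\in L^2_{\mathbb C^d}$ supported in $Q_0$ and all sequences $(A_Q)_{Q\in\mathcal D(Q_0)}$ of positive semidefinite $d\times d$ matrices with $\frac{1}{|K|}\sum_{Q\in\mathcal D(K)}A_Q\le\mathbf 1$ for all $K\in\mathcal D(Q_0)$.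
   Context: $Q_0=[0,1]$ carries its dyadic filtration. For a dyadic interval $K\subseteq Q_0$, $\mathcal D(K)$ denotes the collection of all dyadic subintervals of $K$ (including $K$ itself), and $|K|$ is the Lebesgue measure of $K$. A $d\times d$ matrix weight on $Q_0$ is a measurable $d\times d$ (complex) matrix-valued function $W$ such that $W(x)$ is positive semidefinite for almost every $x$ and both $W$ and $W^{-1}$ are locally integrable (in particular $W(x)$ is invertible for a.e. $x$, and $W$, $W^{-1}$ are integrable on $Q_0$). For a scalar-, vector- or matrix-valued function $h$, $\langle h\rangle_Q=\frac1{|Q|}\int_Q h\,dx$ is its average over $Q$. $L^2_{\mathbb C^d}$ is the unweighted space of functions $f:Q_0\to\mathbb C^d$ with $\|f\|_{L^2_{\mathbb C^d}}^2=\int_{Q_0}\|f(x)\|_{\mathbb C^d}^2\,dx<\infty$. $\mathbf 1$ is the $d\times d$ identity matrix. The conditioning number of the matrix weight is $$[W]_{C_2}=\operatorname*{ess\,sup}_{x\in Q_0}\|W(x)\|_{\mathrm{op}}\|W^{-1}(x)\|_{\mathrm{op}}=\operatorname*{ess\,sup}_{x\in Q_0}\frac{\lambda_{\max}(W(x))}{\lambda_{\min}(W(x))}\in[1,\infty],$$ where $\|\cdot\|_{\mathrm{op}}$ is the operator norm and $\lambda_{\max},\lambda_{\min}$ are the largest and smallest eigenvalues. *)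

theory Defs
  imports "HOL-Analysis.Analysis" "HOL-Probability.Essential_Supremum"
begin

definition hermitian :: "complex^'n^'n \<Rightarrow> bool" where
  "hermitian A \<longleftrightarrow> (\<forall>i j. A $ i $ j = cnj (A $ j $ i))"

definition psd :: "complex^'n^'n \<Rightarrow> bool" where
  "psd A \<longleftrightarrow> hermitian A \<and> (\<forall>x. 0 \<le> Re (\<Sum>i\<in>UNIV. cnj (x $ i) * (A *v x) $ i))"

definition loewner_le :: "complex^'n^'n \<Rightarrow> complex^'n^'n \<Rightarrow> bool" (infix "\<preceq>" 50) where
  "A \<preceq> B \<longleftrightarrow> psd (B - A)"

text \<open>The positive semidefinite square root. It exists uniquely for positive semidefinite \<open>A\<close>;
  the value on other matrices is unspecified.\<close>

definition msqrt :: "complex^'n^'n \<Rightarrow> complex^'n^'n" where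
  "msqrt A = (THE B. psd B \<and> B ** B = A)"

text \<open>Closed dyadic intervals are used, so that \<open>[0,1]\<close> itself is one of them; endpoints are
  null sets and the inclusions are the same as for half-open intervals.\<close>

definition dyadic :: "real set set" where
  "dyadic = {{real k / 2 ^ n .. (real k + 1) / 2 ^ n} | k n :: nat. k < 2 ^ n}"

definition dyadic_in :: "real set \<Rightarrow> real set set" where
  "dyadic_in K = {Q \<in> dyadic. Q \<subseteq> K}"

definition avg :: "real set \<Rightarrow> (real \<Rightarrow> 'a::{banach, second_countable_topology}) \<Rightarrow> 'a" where
  "avg Q h = (1 / measure lebesgue Q) *\<^sub>R integral\<^sup>L (lebesgue_on Q) h"

text \<open>Invertibility is required separately since \<^const>\<open>matrix_inv\<close> is unspecified on singular
  matrices. Measurability of \<open>W\<close> is part of \<^const>\<open>integrable\<close>.\<close>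

definition matrix_weight :: "(real \<Rightarrow> complex^'n^'n) \<Rightarrow> bool" where
  "matrix_weight W \<longleftrightarrow>
     (AE x in lebesgue_on {0..1}. psd (W x) \<and> invertible (W x)) \<and>
     integrable (lebesgue_on {0..1}) W \<and>
     integrable (lebesgue_on {0..1}) (\<lambda>x. matrix_inv (W x))"

definition cond_number :: "(real \<Rightarrow> complex^'n^'n) \<Rightarrow> ennreal" where
  "cond_number W = esssup (lebesgue_on {0..1})
     (\<lambda>x. ennreal (onorm ((*v) (W x)) * onorm ((*v) (matrix_inv (W x)))))"

text \<open>Functions on \<open>[0,1]\<close> are total functions on the reals, of which only the values
  on \<open>[0,1]\<close> are used.\<close>

definition L2 :: "(real \<Rightarrow> complex^'n) set" where
  "L2 = {f. f \<in> borel_measurable (lebesgue_on {0..1}) \<and>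
            integrable (lebesgue_on {0..1}) (\<lambda>x. (norm (f x))\<^sup>2)}"

definition L2_norm :: "(real \<Rightarrow> complex^'n) \<Rightarrow> real" where
  "L2_norm f = sqrt (integral\<^sup>L (lebesgue_on {0..1}) (\<lambda>x. (norm (f x))\<^sup>2))"

text \<open>Convergence of the matrix series is part of the condition, because \<^const>\<open>infsum\<close> is zero
  for divergent series. For positive semidefinite terms convergence is equivalent to
  boundedness of the finite partial sums.\<close>

definition carleson :: "real \<Rightarrow> (real set \<Rightarrow> complex^'n^'n) \<Rightarrow> bool" where
  "carleson C A \<longleftrightarrow>
     (\<forall>Q\<in>dyadic. psd (A Q)) \<and>
     (\<forall>K\<in>dyadic. A summable_on dyadic_in K \<and>
        (1 / measure lebesgue K) *\<^sub>R (\<Sum>\<^sub>\<infinity>Q\<in>dyadic_in K. A Q) \<preceq> C *\<^sub>R mat 1)"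

definition bilinear_sum ::
  "(real set \<Rightarrow> complex^'n^'n) \<Rightarrow> (real \<Rightarrow> complex^'n^'n) \<Rightarrow>
   (real \<Rightarrow> complex^'n) \<Rightarrow> (real \<Rightarrow> complex^'n) \<Rightarrow> ennreal" where
  "bilinear_sum A W f g = (\<Sum>\<^sub>\<infinity>Q\<in>dyadic_in {0..1}. ennreal
     (norm (msqrt (A Q) *v (matrix_inv (avg Q W) *v avg Q (\<lambda>x. msqrt (W x) *v f x))) *
      norm (msqrt (A Q) *v (matrix_inv (avg Q (\<lambda>x. matrix_inv (W x))) *v
              avg Q (\<lambda>x. msqrt (matrix_inv (W x)) *v g x)))))"

end

theory Submission imports Defs begin

text \<open>
  Throughout, \<open>W\<close> is a matrix weight of size \<open>d = CARD('n)\<close>. For a dyadic interval \<open>Q\<close> let \<open>p(Q)\<close> and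
  \<open>q(Q)\<close> be the norms of the weighted averages of \<open>f\<close> and \<open>g\<close>, that is, of
  \<open>\<langle>W\<rangle>\<^sup>-\<^sup>1 \<langle>W\<^sup>1\<^sup>/\<^sup>2 f\<rangle>\<close> and of \<open>\<langle>W\<^sup>-\<^sup>1\<rangle>\<^sup>-\<^sup>1 \<langle>W\<^sup>-\<^sup>1\<^sup>/\<^sup>2 g\<rangle>\<close> over \<open>Q\<close>.

  Upper bound. A positive semidefinite matrix is dominated by its trace, so the \<open>Q\<close>-th term is at most
  \<open>tr A(Q) p(Q) q(Q)\<close>, and the traces form a scalar Carleson sequence (\<open>carleson_trace\<close>). Its sum against
  \<open>p q\<close> is controlled by the integral of the product of the dyadic maximal functions of \<open>p\<close> and \<open>q\<close>
  (\<open>carleson_tree_bound\<close>). Let \<open>l\<close> and \<open>m\<close> be the reciprocals of the norms of \<open>W\<^sup>-\<^sup>1\<close> and of \<open>W\<close>. They are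
  scalar minorants of \<open>W\<close> and \<open>W\<^sup>-\<^sup>1\<close>, and \<open>1 / (l m)\<close> is at most a multiple of the condition number.
  Inserting \<open>1 \<le> E (l m)\<^sup>1\<^sup>/\<^sup>2\<close>, with \<open>E\<close> a multiple of the square root of the condition number, and using
  the Cauchy--Schwarz inequality leaves the two maximal functions in \<open>L\<^sup>2(l)\<close> and \<open>L\<^sup>2(m)\<close>. Each of them
  is bounded there by twice the norm of \<open>f\<close> or \<open>g\<close>, whatever the weight (\<open>weighted_maximal\<close>). This is
  where the matrix structure matters, and it is proved on finite dyadic trees with the Bellman function
  \<open>F - X \<bullet> (M + T)\<^sup>-\<^sup>1 X\<close>, whose mass variable \<open>T\<close> is a scalar below \<open>M\<close>: replacing \<open>M + T\<close> by \<open>M\<close> then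
  costs a factor of two at most, although matrices need not commute (\<open>matrix_maximal_tree\<close>).

  Necessity. Put the mass of the Carleson sequence at a single interval \<open>K\<close>, as \<open>|K|\<close> times the identity,
  and take \<open>f = 1\<^sub>K W\<^sup>1\<^sup>/\<^sup>2 u\<close> and \<open>g = 1\<^sub>K W\<^sup>-\<^sup>1\<^sup>/\<^sup>2 v\<close>. The weighted averages are \<open>u\<close> and \<open>v\<close>, and the
  assumed bound says that \<open>|u| |v|\<close> is at most \<open>C'\<close> times the geometric mean of \<open>u \<bullet> \<langle>W\<rangle> u\<close> and
  \<open>v \<bullet> \<langle>W\<^sup>-\<^sup>1\<rangle> v\<close> (\<open>single_interval_test\<close>). Shrinking \<open>K\<close> to a point and choosing \<open>u = W\<^sup>-\<^sup>1 z\<close>, \<open>v = W y\<close>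
  bounds the condition number by \<open>C'\<^sup>2\<close> (\<open>cond_number_finite\<close>).

  Optimality. The same test on the unit interval for the constant weight \<open>diag (\<kappa>, 1, \<dots>, 1)\<close>, whose condition
  number is at most \<open>\<kappa>\<close>, shows that the constant is at least \<open>\<kappa>\<^sup>1\<^sup>/\<^sup>2\<close> (\<open>exponent_lower_bound\<close>).

  All of this presupposes that positive semidefinite matrices have a unique positive semidefinite square
  root and that it depends measurably on the matrix. Existence and measurability come from a convergent
  polynomial iteration.
\<close>

section \<open>Positive semidefinite matrices\<close>

text \<open>The inner product that the library puts on \<open>complex^'n\<close> is real: it is the real part of the
  complex one. Every quadratic form below is written with it, so positivity arguments take place in
  a real inner product space in which a Hermitian matrix is a symmetric operator.\<close>

lemma hermitian_inner:
  fixes A :: "complex^'n^'n"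
  assumes "hermitian A"
  shows "x \<bullet> (A *v y) = (A *v x) \<bullet> y"
proof -
  have h: "A $ i $ j = cnj (A $ j $ i)" for i j using assms unfolding hermitian_def by blast
  have ip: "u \<bullet> v = Re (\<Sum>i\<in>UNIV. cnj (u $ i) * v $ i)" for u v :: "complex^'n"
    by (simp add: inner_vec_def inner_complex_def)
  have "x \<bullet> (A *v y) = Re (\<Sum>i\<in>UNIV. \<Sum>j\<in>UNIV. cnj (x $ i) * (A $ i $ j * y $ j))"
    unfolding ip by (simp only: matrix_vector_mult_def vec_lambda_beta sum_distrib_left)
  also have "\<dots> = Re (\<Sum>j\<in>UNIV. \<Sum>i\<in>UNIV. cnj (x $ i) * (A $ i $ j * y $ j))"
    by (subst sum.swap) simp
  also have "\<dots> = Re (\<Sum>j\<in>UNIV. \<Sum>i\<in>UNIV. cnj (A $ j $ i * x $ i) * y $ j)"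
  proof -
    have "cnj (x $ i) * (A $ i $ j * y $ j) = cnj (A $ j $ i * x $ i) * y $ j" for i j
      by (subst h[of i j]) simp
    then show ?thesis by (simp only:)
  qed
  also have "\<dots> = (A *v x) \<bullet> y"
    unfolding ip by (simp only: matrix_vector_mult_def vec_lambda_beta sum_distrib_right cnj_sum)
  finally show ?thesis .
qed

lemma psd_iff_inner:
  fixes A :: "complex^'n^'n"
  shows "psd A \<longleftrightarrow> hermitian A \<and> (\<forall>x. 0 \<le> x \<bullet> (A *v x))"
proof -
  have "Re (\<Sum>i\<in>UNIV. cnj (x $ i) * (A *v x) $ i) = x \<bullet> (A *v x)" for x
    by (simp add: inner_vec_def inner_complex_def)
  then show ?thesis by (simp add: psd_def)
qed

lemma psdD:
  fixes A :: "complex^'n^'n"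
  assumes "psd A"
  shows psd_nonneg: "0 \<le> x \<bullet> (A *v x)" and psd_inner: "x \<bullet> (A *v y) = (A *v x) \<bullet> y"
  using assms hermitian_inner by (auto simp: psd_iff_inner)

lemma mv_scaleR: "((c *\<^sub>R A) *v x) = c *\<^sub>R ((A::complex^'n^'m) *v x)"
  by (simp add: matrix_vector_mult_def vec_eq_iff scaleR_sum_right)

lemma mv_scaleR_right: "(A *v (c *\<^sub>R x)) = c *\<^sub>R ((A::complex^'n^'m) *v x)"
  by (simp add: matrix_vector_mult_def vec_eq_iff scaleR_sum_right)

text \<open>The norm on matrices is the Frobenius norm, so this is Cauchy--Schwarz on each row.\<close>

lemma norm_mv: "norm ((A::complex^'n^'m) *v x) \<le> norm A * norm x"
proof -
  have row: "norm ((A *v x) $ i) \<le> norm (A $ i) * norm x" for i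
  proof -
    have "norm ((A *v x) $ i) \<le> (\<Sum>j\<in>UNIV. norm (A $ i $ j) * norm (x $ j))"
      unfolding matrix_vector_mult_def by (simp add: sum_norm_le norm_mult)
    also have "\<dots> \<le> norm (A $ i) * norm x"
      unfolding norm_vec_def using L2_set_mult_ineq[of "\<lambda>j. norm (A $ i $ j)" "\<lambda>j. norm (x $ j)" UNIV] by simp
    finally show ?thesis .
  qed
  have "norm (A *v x) = L2_set (\<lambda>i. norm ((A *v x) $ i)) UNIV"
    by (simp add: norm_vec_def)
  also have "\<dots> \<le> L2_set (\<lambda>i. norm (A $ i) * norm x) UNIV"
    by (intro L2_set_mono row) auto
  also have "\<dots> = L2_set (\<lambda>i. norm (A $ i)) UNIV * norm x"
    by (simp add: L2_set_left_distrib)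
  also have "\<dots> = norm A * norm x" by (simp add: norm_vec_def)
  finally show ?thesis .
qed

lemma bounded_bilinear_mv: "bounded_bilinear (\<lambda>(A::complex^'n^'m) x. A *v x)"
proof (rule bounded_bilinear.intro)
  show "\<exists>K. \<forall>A x. norm ((A::complex^'n^'m) *v x) \<le> norm A * norm x * K"
    using norm_mv by (intro exI[of _ 1]) auto
qed (simp_all add: matrix_vector_mult_add_rdistrib matrix_vector_right_distrib mv_scaleR mv_scaleR_right)

text \<open>The discriminant argument for the possibly degenerate form \<open>x \<bullet> A y\<close>; where the form
  degenerates at \<open>y\<close>, a large multiple of \<open>y\<close> forces the mixed term to vanish.\<close>

lemma psd_Cauchy_Schwarz:
  fixes A :: "complex^'n^'n"
  assumes "psd A"
  shows "(x \<bullet> (A *v y))\<^sup>2 \<le> (x \<bullet> (A *v x)) * (y \<bullet> (A *v y))"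
proof -
  let ?a = "x \<bullet> (A *v x)" and ?b = "x \<bullet> (A *v y)" and ?c = "y \<bullet> (A *v y)"
  have sym: "y \<bullet> (A *v x) = ?b"
    using psd_inner[OF assms, of y x] by (simp add: inner_commute)
  have quad: "0 \<le> ?a - 2 * t * ?b + t\<^sup>2 * ?c" for t
  proof -
    have "0 \<le> (x - t *\<^sub>R y) \<bullet> (A *v (x - t *\<^sub>R y))" by (rule psd_nonneg[OF assms])
    also have "\<dots> = ?a - 2 * t * ?b + t\<^sup>2 * ?c"
      by (simp add: matrix_vector_mult_diff_distrib mv_scaleR_right inner_diff_left inner_diff_right sym
          power2_eq_square algebra_simps)
    finally show ?thesis .
  qed
  show ?thesis
  proof (cases "?c = 0")
    case True
    have "?b = 0"
    proof (rule ccontr)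
      assume "?b \<noteq> 0"
      with quad[of "(?a + 1) / (2 * ?b)"] True show False by (simp add: field_simps)
    qed
    then show ?thesis using True by simp
  next
    case False
    then have "?c > 0" using psd_nonneg[OF assms, of y] by simp
    with quad[of "?b / ?c"] show ?thesis by (simp add: power2_eq_square field_simps)
  qed
qed

text \<open>Cauchy--Schwarz for the form of \<open>A\<close>, applied to \<open>A x\<close> and \<open>x\<close>.\<close>

lemma psd_norm_sq_le:
  fixes A :: "complex^'n^'n"
  assumes "psd A" and t: "\<And>u. u \<bullet> (A *v u) \<le> t * (norm u)\<^sup>2"
  shows "(norm (A *v x))\<^sup>2 \<le> t * (x \<bullet> (A *v x))"
proof (cases "A *v x = 0")
  case False
  let ?y = "A *v x"
  have "((norm ?y)\<^sup>2)\<^sup>2 = (?y \<bullet> (A *v x))\<^sup>2" by (simp add: power2_norm_eq_inner)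
  also have "\<dots> \<le> (?y \<bullet> (A *v ?y)) * (x \<bullet> (A *v x))" by (rule psd_Cauchy_Schwarz[OF assms(1)])
  also have "\<dots> \<le> (t * (norm ?y)\<^sup>2) * (x \<bullet> (A *v x))"
    by (intro mult_right_mono t psd_nonneg assms)
  finally have "(norm ?y)\<^sup>2 * (norm ?y)\<^sup>2 \<le> (norm ?y)\<^sup>2 * (t * (x \<bullet> (A *v x)))"
    by (simp add: power2_eq_square algebra_simps)
  moreover have "0 < (norm ?y)\<^sup>2" using False by simp
  ultimately show ?thesis by (simp only: mult_le_cancel_left_pos)
qed (use psd_nonneg[OF assms(1), of x] in simp)

lemma inner_mv_le_norm: "x \<bullet> ((A::complex^'n^'n) *v x) \<le> norm A * (norm x)\<^sup>2"
proof -
  have "x \<bullet> (A *v x) \<le> norm x * norm (A *v x)" by (rule norm_cauchy_schwarz)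
  also have "\<dots> \<le> norm x * (norm A * norm x)" by (intro mult_left_mono norm_mv) auto
  finally show ?thesis by (simp add: power2_eq_square algebra_simps)
qed

lemma psd_isotropic:
  fixes A :: "complex^'n^'n"
  assumes "psd A" "x \<bullet> (A *v x) = 0"
  shows "A *v x = 0"
  using psd_norm_sq_le[OF assms(1) inner_mv_le_norm, of x] assms(2) by simp

lemma hermitian_mult_self:
  assumes "hermitian A" shows "hermitian (A ** A)"
  unfolding hermitian_def
proof (intro allI)
  fix i j
  have h: "A $ i $ j = cnj (A $ j $ i)" for i j using assms unfolding hermitian_def by blast
  have "cnj ((A ** A) $ j $ i) = (\<Sum>k\<in>UNIV. cnj (A $ j $ k) * cnj (A $ k $ i))"
    by (simp add: matrix_matrix_mult_def)
  also have "\<dots> = (\<Sum>k\<in>UNIV. A $ i $ k * A $ k $ j)"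
    by (intro sum.cong refl) (metis h mult.commute)
  finally show "(A ** A) $ i $ j = cnj ((A ** A) $ j $ i)"
    by (simp add: matrix_matrix_mult_def)
qed

lemma mat_eqI: fixes A B :: "complex^'n^'n" assumes "\<And>x. A *v x = B *v x" shows "A = B"
  using assms by (simp add: matrix_eq)

lemma mv_axis: "((A::complex^'n^'m) *v axis j 1) $ i = A $ i $ j"
  by (simp add: matrix_vector_mult_def axis_def if_distrib cong: if_cong)

lemma axis_inner: "axis i 1 \<bullet> ((A::complex^'n^'n) *v axis i 1) = Re (A $ i $ i)"
  by (simp add: inner_axis' inner_complex_def mv_axis)

lemma Re_trace: "Re (trace (A::complex^'n^'n)) = (\<Sum>i\<in>UNIV. axis i 1 \<bullet> (A *v axis i 1))"
  by (simp add: axis_inner trace_def)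

lemma mv_sub: "(A - B) *v x = A *v x - (B::complex^'n^'n) *v x"
  by (rule matrix_vector_mult_diff_rdistrib)

lemma mv_minus: "(- A) *v x = - ((A::complex^'n^'n) *v x)"
  using mv_scaleR[of "-1" A x] by simp

text \<open>With \<open>D = B - C\<close>, the equality of the squares gives \<open>B D = - D C\<close>. Cyclicity of the trace turns
  this into \<open>tr (D B D) + tr (D C D) = 0\<close>, a sum of nonnegative terms. Hence \<open>B\<close> and \<open>C\<close> both
  annihilate the range of \<open>D\<close>, so \<open>D D = 0\<close>, and \<open>D = 0\<close> by symmetry.\<close>

lemma psd_square_root_unique:
  fixes B C :: "complex^'n^'n"
  assumes B: "psd B" and C: "psd C" and eq: "B ** B = C ** C"
  shows "B = C"
proof -
  define D where "D = B - C"
  have Dsym: "x \<bullet> (D *v y) = (D *v x) \<bullet> y" for x y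
    unfolding D_def by (simp add: mv_sub inner_diff_left inner_diff_right psd_inner[OF B] psd_inner[OF C])
  have BD: "B *v (D *v x) = - (D *v (C *v x))" for x
  proof -
    have "B *v (B *v x) = C *v (C *v x)"
      using eq by (simp add: matrix_vector_mul_assoc)
    then show ?thesis
      unfolding D_def by (simp add: mv_sub matrix_vector_mult_diff_distrib del: matrix_vector_mul_assoc)
  qed
  have "trace (D ** (B ** D)) = trace (D ** ((- D) ** C))"
  proof -
    have "B ** D = (- D) ** C"
      by (rule mat_eqI) (simp add: BD mv_minus flip: matrix_vector_mul_assoc)
    then show ?thesis by simp
  qed
  also have "\<dots> = trace ((- D) ** C ** D)" by (rule trace_mul_sym)
  finally have tr: "Re (trace (D ** (B ** D))) = Re (trace (- D ** C ** D))" by simp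
  have "(\<Sum>i\<in>UNIV. (D *v axis i 1) \<bullet> (B *v (D *v axis i 1)) + (D *v axis i 1) \<bullet> (C *v (D *v axis i 1))) = 0"
    using tr unfolding Re_trace
    by (simp add: sum.distrib Dsym mv_minus sum_negf flip: matrix_vector_mul_assoc)
  then have z: "(D *v axis i 1) \<bullet> (B *v (D *v axis i 1)) + (D *v axis i 1) \<bullet> (C *v (D *v axis i 1)) = 0" for i
    by (subst (asm) sum_nonneg_eq_0_iff) (auto intro!: add_nonneg_nonneg psd_nonneg[OF B] psd_nonneg[OF C])
  have "D *v axis i 1 = 0" for i
  proof -
    let ?u = "D *v axis i (1::complex)"
    have "?u \<bullet> (B *v ?u) = 0" "?u \<bullet> (C *v ?u) = 0"
      using z[of i] psd_nonneg[OF B, of ?u] psd_nonneg[OF C, of ?u] by auto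
    then have "B *v ?u = 0" "C *v ?u = 0" using psd_isotropic B C by auto
    then have "D *v ?u = 0" by (simp add: D_def mv_sub)
    then have "?u \<bullet> ?u = 0" using Dsym[of "axis i 1" ?u] by simp
    then show ?thesis by simp
  qed
  then have "D = 0"
    by (simp add: vec_eq_iff mv_axis)
  then show ?thesis by (simp add: D_def)
qed

section \<open>Existence and continuity of the square root\<close>

text \<open>An operator norm bound, stated without the operator norm so that it can be added and
  multiplied along the iteration below.\<close>

definition op_bound :: "real \<Rightarrow> complex^'n^'n \<Rightarrow> bool" where
  "op_bound c A \<longleftrightarrow> (\<forall>v. norm (A *v v) \<le> c * norm v)"

lemma op_bound_add: "op_bound a A \<Longrightarrow> op_bound b B \<Longrightarrow> op_bound (a + b) (A + B)"
  unfolding op_bound_def matrix_vector_mult_add_rdistrib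
  by (metis add_mono distrib_right norm_triangle_mono order_refl)

lemma op_bound_scaleR: "op_bound a A \<Longrightarrow> 0 \<le> c \<Longrightarrow> op_bound (c * a) (c *\<^sub>R A)"
  unfolding op_bound_def by (simp add: mv_scaleR mult_left_mono mult.assoc)

lemma op_bound_mult:
  assumes "op_bound a A" "op_bound b B" "0 \<le> a" shows "op_bound (a * b) (A ** B)"
  unfolding op_bound_def
proof
  fix v
  have "norm (A *v (B *v v)) \<le> a * norm (B *v v)" using assms(1) by (simp add: op_bound_def)
  also have "\<dots> \<le> a * (b * norm v)" using assms(2,3) by (intro mult_left_mono) (simp_all add: op_bound_def)
  finally show "norm ((A ** B) *v v) \<le> a * b * norm v" by (simp add: matrix_vector_mul_assoc)
qed

lemma norm_axis_complex: "norm (axis j (1::complex)) = 1"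
  by (simp add: norm_eq_1 inner_axis_axis inner_complex_def)

lemma norm_le_op_bound:
  fixes A :: "complex^'n^'n"
  assumes "op_bound c A"
  shows "norm A \<le> real CARD('n)^2 * c"
proof -
  have e: "norm (A $ i $ j) \<le> c" for i j
  proof -
    have "norm (A $ i $ j) = norm ((A *v axis j 1) $ i)" by (simp add: mv_axis)
    also have "\<dots> \<le> norm (A *v axis j 1)" by (rule Finite_Cartesian_Product.norm_nth_le)
    also have "\<dots> \<le> c * norm (axis j (1::complex) :: complex^'n)"
      using assms unfolding op_bound_def by blast
    finally show ?thesis by (simp add: norm_axis_complex)
  qed
  have "norm A \<le> (\<Sum>i\<in>UNIV. norm (A $ i))" unfolding norm_vec_def by (rule L2_set_le_sum) simp
  also have "\<dots> \<le> (\<Sum>i\<in>UNIV. \<Sum>j\<in>UNIV. norm (A $ i $ j))"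
    by (intro sum_mono) (unfold norm_vec_def, rule L2_set_le_sum, simp)
  also have "\<dots> \<le> (\<Sum>i\<in>(UNIV::'n set). \<Sum>j\<in>(UNIV::'n set). c)"
    by (intro sum_mono e)
  finally show ?thesis by (simp add: power2_eq_square)
qed

text \<open>If \<open>Y\<close> is a fixed point, then \<open>(1 - Y)\<^sup>2 = 1 - C\<close>. So the limit of this iteration yields a square
  root of \<open>1 - C\<close>, by polynomials in \<open>C\<close>; in particular as a pointwise limit of continuous
  functions of \<open>C\<close>.\<close>

primrec sqrt_iter :: "nat \<Rightarrow> complex^'n^'n \<Rightarrow> complex^'n^'n" where
  "sqrt_iter 0 C = 0"
| "sqrt_iter (Suc n) C = (1/2) *\<^sub>R (C + sqrt_iter n C ** sqrt_iter n C)"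

text \<open>The same iteration for the number \<open>C = 1\<close>. Since all coefficients are nonnegative, it
  majorises the matrix iteration for every contraction \<open>C\<close>.\<close>

primrec sqrt_bd :: "nat \<Rightarrow> real" where
  "sqrt_bd 0 = 0"
| "sqrt_bd (Suc n) = (1 + (sqrt_bd n)\<^sup>2) / 2"

lemma sqrt_bd_bounds: "0 \<le> sqrt_bd n \<and> sqrt_bd n \<le> 1"
  by (induction n) (auto simp: power_le_one)

lemma sqrt_bd_mono: "sqrt_bd n \<le> sqrt_bd (Suc n)"
proof -
  have "0 \<le> (1 - sqrt_bd n)\<^sup>2" by simp
  then show ?thesis by (simp add: power2_eq_square algebra_simps)
qed

lemma op_bound_sqrt_iter:
  assumes "op_bound 1 C" shows "op_bound (sqrt_bd n) (sqrt_iter n C)"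
proof (induction n)
  case (Suc n)
  show ?case
    using op_bound_scaleR[OF op_bound_add[OF assms op_bound_mult[OF Suc Suc]], of "1/2"] sqrt_bd_bounds[of n]
    by (simp add: power2_eq_square)
qed (simp add: op_bound_def)

text \<open>The difference of consecutive squares is \<open>b (b - a) + (b - a) a\<close>, in this order of the factors,
  and \<open>sqrt_bd\<close> satisfies the same recursion with equality.\<close>

lemma op_bound_sqrt_iter_step:
  assumes "op_bound 1 C" shows "op_bound (sqrt_bd (Suc n) - sqrt_bd n) (sqrt_iter (Suc n) C - sqrt_iter n C)"
proof (induction n)
  case 0
  then show ?case using op_bound_scaleR[OF assms, of "1/2"] by (simp add: matrix_matrix_mult_def zero_vec_def[symmetric] flip: zero_vec_def)
next
  case (Suc n)
  let ?a = "sqrt_iter n C" and ?b = "sqrt_iter (Suc n) C"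
  let ?x = "sqrt_bd n" and ?y = "sqrt_bd (Suc n)"
  have "?b ** ?b - ?a ** ?a = ?b ** (?b - ?a) + (?b - ?a) ** ?a"
    by (rule mat_eqI) (simp add: mv_sub matrix_vector_mult_add_rdistrib matrix_vector_mult_diff_distrib
        flip: matrix_vector_mul_assoc del: sqrt_iter.simps)
  then have "sqrt_iter (Suc (Suc n)) C - ?b = (1/2) *\<^sub>R (?b ** (?b - ?a) + (?b - ?a) ** ?a)"
    by (simp add: scaleR_diff_right[symmetric] del: scaleR_half_double)
  moreover have "op_bound (1/2 * (?y * (?y - ?x) + (?y - ?x) * ?x)) ((1/2) *\<^sub>R (?b ** (?b - ?a) + (?b - ?a) ** ?a))"
    by (intro op_bound_scaleR op_bound_add op_bound_mult Suc op_bound_sqrt_iter assms)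
       (use sqrt_bd_bounds[of "Suc n"] sqrt_bd_mono[of n] in auto)
  moreover have "1/2 * (?y * (?y - ?x) + (?y - ?x) * ?x) = sqrt_bd (Suc (Suc n)) - ?y"
    by (simp add: power2_eq_square field_simps)
  ultimately show ?case by metis
qed

lemma op_bound_sqrt_iter_diff:
  assumes "op_bound 1 C" shows "op_bound (sqrt_bd (n + k) - sqrt_bd n) (sqrt_iter (n + k) C - sqrt_iter n C)"
proof (induction k)
  case (Suc k)
  from op_bound_add[OF op_bound_sqrt_iter_step[OF assms, of "n + k"] Suc] show ?case by simp
qed (simp add: op_bound_def)

lemma convergent_sqrt_iter:
  fixes C :: "complex^'n^'n"
  assumes "op_bound 1 C" shows "convergent (\<lambda>n. sqrt_iter n C)"
proof -
  have "incseq sqrt_bd" by (intro incseq_SucI sqrt_bd_mono)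
  then have "convergent sqrt_bd"
    using sqrt_bd_bounds by (intro Bseq_mono_convergent BseqI'[of _ 1]) (auto simp: incseq_def)
  then have Cy: "Cauchy sqrt_bd" by (simp add: Cauchy_convergent_iff)
  have le: "norm (sqrt_iter m C - sqrt_iter n C) \<le> real CARD('n)^2 * norm (sqrt_bd m - sqrt_bd n)" for m n
  proof -
    have *: "norm (sqrt_iter m C - sqrt_iter n C) \<le> real CARD('n)^2 * norm (sqrt_bd m - sqrt_bd n)" if "n \<le> m" for m n
    proof -
      have "norm (sqrt_iter m C - sqrt_iter n C) \<le> real CARD('n)^2 * (sqrt_bd m - sqrt_bd n)"
        using norm_le_op_bound[OF op_bound_sqrt_iter_diff[OF assms, of n "m - n"]] that by simp
      also have "\<dots> \<le> real CARD('n)^2 * norm (sqrt_bd m - sqrt_bd n)"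
        by (intro mult_left_mono) auto
      finally show ?thesis .
    qed
    show ?thesis
      using *[of n m] *[of m n] by (cases "n \<le> m") (auto simp: norm_minus_commute abs_minus_commute)
  qed
  have "Cauchy (\<lambda>n. sqrt_iter n C)"
  proof (rule CauchyI)
    fix e :: real assume "0 < e"
    then have "0 < e / real CARD('n)^2" by simp
    from CauchyD[OF Cy this] obtain M where M: "\<And>m n. M \<le> m \<Longrightarrow> M \<le> n \<Longrightarrow> norm (sqrt_bd m - sqrt_bd n) < e / real CARD('n)^2"
      by blast
    show "\<exists>M. \<forall>m\<ge>M. \<forall>n\<ge>M. norm (sqrt_iter m C - sqrt_iter n C) < e"
    proof (intro exI[of _ M] allI impI)
      fix m n assume "M \<le> m" "M \<le> n"
      then have "real CARD('n)^2 * norm (sqrt_bd m - sqrt_bd n) < e"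
        using M[of m n] by (simp add: field_simps)
      with le[of m n] show "norm (sqrt_iter m C - sqrt_iter n C) < e" by simp
    qed
  qed
  then show ?thesis by (simp add: Cauchy_convergent_iff)
qed

lemma tendsto_matrix_mult:
  fixes f g :: "'a \<Rightarrow> complex^'n^'n"
  assumes "(f \<longlongrightarrow> a) F" "(g \<longlongrightarrow> b) F"
  shows "((\<lambda>x. f x ** g x) \<longlongrightarrow> a ** b) F"
  unfolding matrix_matrix_mult_def
  by (intro vec_tendstoI) (simp, intro tendsto_intros assms)

lemma hermitian_add:
  assumes "hermitian A" "hermitian B" shows "hermitian (A + B)"
proof -
  have "A $ i $ j = cnj (A $ j $ i)" "B $ i $ j = cnj (B $ j $ i)" for i j
    using assms unfolding hermitian_def by blast+
  note this[of i j for i j]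
  then show ?thesis unfolding hermitian_def by (metis complex_cnj_add vector_add_component)
qed

lemma hermitian_scaleR:
  assumes "hermitian A" shows "hermitian (c *\<^sub>R A)"
proof -
  have "A $ i $ j = cnj (A $ j $ i)" for i j
    using assms unfolding hermitian_def by blast
  then show ?thesis unfolding hermitian_def by (metis complex_cnj_scaleR vector_scaleR_component)
qed

lemma hermitian_diff:
  assumes "hermitian A" "hermitian B" shows "hermitian (A - B)"
  using hermitian_add[OF assms(1) hermitian_scaleR[OF assms(2), of "-1"]] by simp

lemma hermitian_sqrt_iter:
  assumes "hermitian C" shows "hermitian (sqrt_iter n C)"
proof (induction n)
  case (Suc n)
  then show ?case
    unfolding sqrt_iter.simps by (intro hermitian_scaleR hermitian_add hermitian_mult_self assms)
qed (simp add: hermitian_def)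

lemma hermitian_lim:
  fixes X :: "nat \<Rightarrow> complex^'n^'n"
  assumes "\<And>n. hermitian (X n)" "X \<longlonglongrightarrow> Y" shows "hermitian Y"
  unfolding hermitian_def
proof (intro allI)
  fix i j
  have "(\<lambda>n. X n $ i $ j) \<longlonglongrightarrow> Y $ i $ j" by (intro tendsto_intros assms)
  moreover have "(\<lambda>n. cnj (X n $ j $ i)) \<longlonglongrightarrow> cnj (Y $ j $ i)" by (intro tendsto_intros assms)
  moreover have "(\<lambda>n. X n $ i $ j) = (\<lambda>n. cnj (X n $ j $ i))"
    using assms(1) unfolding hermitian_def by blast
  ultimately show "Y $ i $ j = cnj (Y $ j $ i)" using LIMSEQ_unique by metis
qed

lemma hermitian_mat1: "hermitian (mat 1)"
  by (auto simp: hermitian_def mat_def)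

text \<open>The iteration needs a contraction; division by \<open>norm A + 1\<close> produces one from any positive
  semidefinite \<open>A\<close>, depends continuously on \<open>A\<close>, and is never a division by zero.\<close>

definition msqrt_approx :: "nat \<Rightarrow> complex^'n^'n \<Rightarrow> complex^'n^'n" where
  "msqrt_approx n A = sqrt (norm A + 1) *\<^sub>R (mat 1 - sqrt_iter n (mat 1 - (1 / (norm A + 1)) *\<^sub>R A))"

text \<open>For positive semidefinite \<open>A\<close>, the matrix \<open>C = 1 - A / t\<close> with \<open>t = norm A + 1\<close> satisfies
  \<open>0 \<le> C \<le> 1\<close>, hence is a contraction, and \<open>sqrt t (1 - Y)\<close> is a root of \<open>A\<close>. This root is positive
  because \<open>Y\<close> is a contraction as well.\<close>

lemma msqrt_approx_limit:
  fixes A :: "complex^'n^'n"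
  assumes A: "psd A"
  obtains B where "(\<lambda>n. msqrt_approx n A) \<longlonglongrightarrow> B" "psd B" "B ** B = A"
proof -
  define t where "t = norm A + 1"
  have t: "t > 0" "norm A \<le> t" by (auto simp: t_def add_nonneg_pos)
  define C where "C = mat 1 - (1 / t) *\<^sub>R A"
  have Cv: "C *v x = x - (1 / t) *\<^sub>R (A *v x)" for x by (simp add: C_def mv_sub mv_scaleR)
  have herm: "hermitian C"
    using A unfolding psd_def C_def by (intro hermitian_diff hermitian_scaleR hermitian_mat1) simp
  have q: "x \<bullet> (C *v x) = (norm x)\<^sup>2 - (x \<bullet> (A *v x)) / t" for x
    by (simp add: Cv inner_diff_right power2_norm_eq_inner)
  have q1: "x \<bullet> (C *v x) \<le> 1 * (norm x)\<^sup>2" for x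
    using psd_nonneg[OF A, of x] t by (simp add: q)
  have psdC: "psd C"
    unfolding psd_iff_inner
  proof (intro conjI herm allI)
    fix x
    have "x \<bullet> (A *v x) \<le> t * (norm x)\<^sup>2"
      using inner_mv_le_norm[of x A] t(2) by (meson mult_right_mono order_trans zero_le_power2)
    then show "0 \<le> x \<bullet> (C *v x)" using t by (simp add: q field_simps)
  qed
  have c1: "op_bound 1 C"
    unfolding op_bound_def
  proof
    fix v
    have "(norm (C *v v))\<^sup>2 \<le> (norm v)\<^sup>2"
      using psd_norm_sq_le[OF psdC q1, of v] q1[of v] by linarith
    then show "norm (C *v v) \<le> 1 * norm v"
      using power2_le_imp_le[of "norm (C *v v)" "norm v"] by (simp only: mult_1_left norm_ge_zero)
  qed
  obtain Y where Y: "(\<lambda>n. sqrt_iter n C) \<longlonglongrightarrow> Y"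
    using convergent_sqrt_iter[OF c1] by (auto simp: convergent_def)
  have "(\<lambda>n. sqrt_iter (Suc n) C) \<longlonglongrightarrow> (1/2) *\<^sub>R (C + Y ** Y)"
    unfolding sqrt_iter.simps by (intro tendsto_intros tendsto_matrix_mult Y)
  then have Yeq: "Y = (1/2) *\<^sub>R (C + Y ** Y)"
    using LIMSEQ_Suc[OF Y] LIMSEQ_unique by blast
  have Yh: "hermitian Y" using hermitian_lim[OF hermitian_sqrt_iter[OF herm] Y] .
  have Yc: "norm (Y *v v) \<le> norm v" for v
  proof (rule tendsto_upperbound)
    show "(\<lambda>n. norm (sqrt_iter n C *v v)) \<longlonglongrightarrow> norm (Y *v v)"
      by (intro tendsto_norm bounded_bilinear.tendsto[OF bounded_bilinear_mv] Y tendsto_const)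
    show "eventually (\<lambda>n. norm (sqrt_iter n C *v v) \<le> norm v) sequentially"
    proof (intro always_eventually allI)
      fix n
      have "norm (sqrt_iter n C *v v) \<le> sqrt_bd n * norm v" using op_bound_sqrt_iter[OF c1] by (simp add: op_bound_def)
      also have "\<dots> \<le> 1 * norm v" using sqrt_bd_bounds by (intro mult_right_mono) auto
      finally show "norm (sqrt_iter n C *v v) \<le> norm v" by simp
    qed
  qed simp
  define B where "B = sqrt t *\<^sub>R (mat 1 - Y)"
  have Bv: "B *v x = sqrt t *\<^sub>R (x - Y *v x)" for x by (simp add: B_def mv_sub mv_scaleR)
  show thesis
  proof
    show "(\<lambda>n. msqrt_approx n A) \<longlonglongrightarrow> B"
      unfolding msqrt_approx_def t_def[symmetric] C_def[symmetric] B_def by (intro tendsto_intros Y)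
    show "psd B"
      unfolding psd_iff_inner
    proof (intro conjI allI)
      show "hermitian B"
        unfolding B_def by (intro hermitian_diff hermitian_scaleR hermitian_mat1 Yh)
      fix x
      have "x \<bullet> (Y *v x) \<le> norm x * norm (Y *v x)" by (rule norm_cauchy_schwarz)
      also have "\<dots> \<le> norm x * norm x" by (intro mult_left_mono Yc) auto
      finally show "0 \<le> x \<bullet> (B *v x)"
        using t by (simp add: Bv inner_diff_right power2_norm_eq_inner[symmetric] power2_eq_square)
    qed
    show "B ** B = A"
    proof (rule mat_eqI)
      fix x
      have "Y *v x = (1/2) *\<^sub>R (C *v x + Y *v (Y *v x))"
        by (subst Yeq) (simp add: mv_scaleR matrix_vector_mult_add_rdistrib matrix_vector_mul_assoc)
      then have "Y *v x + Y *v x = C *v x + Y *v (Y *v x)"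
        by (metis scaleR_half_double scaleR_right_distrib)
      then have "(1/t) *\<^sub>R (A *v x) = x + Y *v (Y *v x) - (Y *v x + Y *v x)"
        by (simp add: Cv algebra_simps)
      moreover have "(B ** B) *v x = t *\<^sub>R (x + Y *v (Y *v x) - (Y *v x + Y *v x))"
      proof -
        have "(B ** B) *v x = sqrt t *\<^sub>R (sqrt t *\<^sub>R ((x - Y *v x) - (Y *v x - Y *v (Y *v x))))"
          by (simp add: matrix_vector_mul_assoc[symmetric] Bv mv_scaleR_right matrix_vector_mult_diff_distrib
              scaleR_right_diff_distrib scaleR_right_distrib)
        also have "\<dots> = t *\<^sub>R ((x - Y *v x) - (Y *v x - Y *v (Y *v x)))"
          using t by (simp only: scaleR_scaleR real_sqrt_mult_self abs_of_pos)
        also have "(x - Y *v x) - (Y *v x - Y *v (Y *v x)) = x + Y *v (Y *v x) - (Y *v x + Y *v x)"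
          by simp
        finally show ?thesis .
      qed
      moreover have "A *v x = t *\<^sub>R ((1/t) *\<^sub>R (A *v x))" using t by simp
      ultimately show "(B ** B) *v x = A *v x" by (simp only:)
    qed
  qed
qed

lemma msqrt_properties:
  fixes A :: "complex^'n^'n"
  assumes A: "psd A"
  shows msqrt_limit: "(\<lambda>n. msqrt_approx n A) \<longlonglongrightarrow> msqrt A"
    and psd_msqrt: "psd (msqrt A)" and msqrt_square: "msqrt A ** msqrt A = A"
proof -
  obtain B where B: "(\<lambda>n. msqrt_approx n A) \<longlonglongrightarrow> B" "psd B" "B ** B = A"
    using msqrt_approx_limit[OF A] .
  have m: "msqrt A = B"
    unfolding msqrt_def
  proof (rule the_equality)
    show "psd B \<and> B ** B = A" using B(2,3) by blast
    show "B' = B" if "psd B' \<and> B' ** B' = A" for B'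
      using psd_square_root_unique[of B' B] that B(2,3) by metis
  qed
  show "(\<lambda>n. msqrt_approx n A) \<longlonglongrightarrow> msqrt A" "psd (msqrt A)" "msqrt A ** msqrt A = A"
    unfolding m by (fact B)+
qed

lemma norm_msqrt:
  assumes "psd A" shows "(norm (msqrt A *v x))\<^sup>2 = x \<bullet> (A *v x)"
proof -
  have "(norm (msqrt A *v x))\<^sup>2 = x \<bullet> (msqrt A *v (msqrt A *v x))"
    by (simp add: power2_norm_eq_inner psd_inner[OF psd_msqrt[OF assms]])
  then show ?thesis by (simp add: matrix_vector_mul_assoc msqrt_square assms)
qed

lemma continuous_sqrt_iter: "continuous_on UNIV (sqrt_iter n :: complex^'n^'n \<Rightarrow> _)"
proof (induction n)
  case (Suc n)
  then show ?case unfolding continuous_on_def sqrt_iter.simps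
    by (intro ballI tendsto_intros tendsto_matrix_mult) auto
qed simp

lemma continuous_sqrt_rescale: "continuous_on UNIV (\<lambda>A :: complex^'n^'n. mat 1 - (1 / (norm A + 1)) *\<^sub>R A)"
proof -
  have nz: "norm A + 1 \<noteq> 0" for A :: "complex^'n^'n" using norm_ge_zero[of A] by linarith
  have "continuous_on UNIV (\<lambda>A :: complex^'n^'n. 1 / (norm A + 1))"
    using nz by (intro continuous_intros) simp
  then show ?thesis 
    by (intro continuous_on_diff continuous_on_const continuous_on_scaleR continuous_on_id)
qed

lemma borel_measurable_msqrt_approx: "(msqrt_approx n :: complex^'n^'n \<Rightarrow> _) \<in> borel_measurable borel"
proof (rule borel_measurable_continuous_onI)
  have c: "continuous_on UNIV (\<lambda>A :: complex^'n^'n. sqrt_iter n (mat 1 - (1 / (norm A + 1)) *\<^sub>R A))"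
    by (rule continuous_on_compose2[OF continuous_sqrt_iter continuous_sqrt_rescale]) simp
  have d: "continuous_on UNIV (\<lambda>A :: complex^'n^'n. sqrt (norm A + 1))"
    by (intro continuous_intros)
  show "continuous_on UNIV (msqrt_approx n :: complex^'n^'n \<Rightarrow> _)"
    unfolding msqrt_approx_def by (rule continuous_on_scaleR[OF d continuous_on_diff[OF continuous_on_const c]])
qed

section \<open>A maximal estimate and a Carleson estimate on dyadic trees\<close>

lemma matrix_inv_mult:
  fixes A :: "complex^'n^'n"
  assumes "invertible A"
  shows "A ** matrix_inv A = mat 1" "matrix_inv A ** A = mat 1"
  using someI_ex[OF assms[unfolded invertible_def]] by (auto simp: matrix_inv_def)

lemma matrix_inv_cancel:
  fixes A :: "complex^'n^'n"
  assumes "invertible A"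
  shows "A *v (matrix_inv A *v x) = x" "matrix_inv A *v (A *v x) = x"
  using matrix_inv_mult[OF assms] by (simp_all add: matrix_vector_mul_assoc)

lemma posdef_invertible:
  fixes A :: "complex^'n^'n"
  assumes "\<And>v. v \<noteq> 0 \<Longrightarrow> v \<bullet> (A *v v) > 0"
  shows "invertible A"
proof -
  have "x = 0" if "A *v x = 0" for x using assms[of x] that by fastforce
  then show ?thesis using matrix_left_invertible_ker[of A] by (auto simp: invertible_left_inverse)
qed

lemma coercive_invertible:
  fixes A :: "complex^'n^'n"
  assumes "\<And>v. l * (norm v)\<^sup>2 \<le> v \<bullet> (A *v v)" "0 < l"
  shows "invertible A"
proof (rule posdef_invertible)
  fix v :: "complex^'n" assume "v \<noteq> 0"
  then have "0 < l * (norm v)\<^sup>2" using assms(2) by simp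
  with assms(1)[of v] show "v \<bullet> (A *v v) > 0" by linarith
qed

lemma resolvent_exists:
  fixes M :: "complex^'n^'n"
  assumes "\<And>v. l * (norm v)\<^sup>2 \<le> v \<bullet> (M *v v)" "0 < l" "0 \<le> T"
  shows "\<exists>y. M *v y + T *\<^sub>R y = X"
proof -
  let ?A = "M + T *\<^sub>R mat 1"
  have Av: "?A *v v = M *v v + T *\<^sub>R v" for v
    by (simp add: matrix_vector_mult_add_rdistrib mv_scaleR)
  have "l * (norm v)\<^sup>2 \<le> v \<bullet> (?A *v v)" for v
    using assms(1)[of v] assms(3) by (simp add: Av inner_add_right add_increasing2)
  then have "invertible ?A" using assms(2) by (rule coercive_invertible)
  then have "?A *v (matrix_inv ?A *v X) = X" by (rule matrix_inv_cancel)
  then show ?thesis unfolding Av by blast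
qed

text \<open>Since \<open>T\<close> is a scalar with \<open>T \<le> l \<le> M\<close>, adding \<open>T\<close> to \<open>M\<close> at most doubles it, and the two
  commute: \<open>M\<^sup>-\<^sup>1 X = y + T M\<^sup>-\<^sup>1 y\<close>, where \<open>T M\<^sup>-\<^sup>1\<close> is a contraction. This is the reason why the
  maximal estimate has a constant that is independent of the dimension and of the weight.\<close>

lemma resolvent_lower_bound:
  fixes M :: "complex^'n^'n"
  assumes M: "\<And>v. l * (norm v)\<^sup>2 \<le> v \<bullet> (M *v v)" "0 < l" and T: "0 \<le> T" "T \<le> l"
    and y: "M *v y + T *\<^sub>R y = X"
  shows "norm (matrix_inv M *v X) \<le> 2 * norm y"
proof -
  have inv: "invertible M" using M by (rule coercive_invertible)
  define z where "z = matrix_inv M *v y"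
  have Mz: "M *v z = y" unfolding z_def by (rule matrix_inv_cancel[OF inv])
  have "matrix_inv M *v X = y + T *\<^sub>R z"
    unfolding y[symmetric] z_def
    by (simp add: matrix_vector_right_distrib mv_scaleR_right matrix_inv_cancel[OF inv] del: matrix_vector_mul_assoc)
  moreover have "T * norm z \<le> norm y"
  proof (cases "z = 0")
    case False
    have "l * (norm z)\<^sup>2 \<le> z \<bullet> y" using M(1)[of z] by (simp add: Mz)
    also have "\<dots> \<le> norm z * norm y" by (rule norm_cauchy_schwarz)
    finally have "norm z * (l * norm z) \<le> norm z * norm y" by (simp add: power2_eq_square algebra_simps)
    then have "l * norm z \<le> norm y" using False by simp
    then show ?thesis using T(2) by (meson mult_right_mono norm_ge_zero order_trans)
  qed simp
  moreover have "norm (y + T *\<^sub>R z) \<le> norm y + T * norm z"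
    using T(1) norm_triangle_ineq[of y "T *\<^sub>R z"] by simp
  ultimately show ?thesis by simp
qed

text \<open>The number \<open>z \<bullet> X\<close> is the maximum over \<open>y\<close> of the concave functional on the left, attained at
  \<open>y = z\<close>. In this form \<open>(M, T, X) \<mapsto> X \<bullet> (M + T)\<^sup>-\<^sup>1 X\<close> is visibly a supremum of linear functions,
  and therefore subadditive.\<close>

lemma resolvent_variational:
  fixes M :: "complex^'n^'n"
  assumes M: "psd M" and T: "0 \<le> T" and z: "M *v z + T *\<^sub>R z = X"
  shows "2 * (y \<bullet> X) - y \<bullet> (M *v y) - T * (norm y)\<^sup>2 \<le> z \<bullet> X"
proof -
  have "0 \<le> (y - z) \<bullet> (M *v (y - z)) + T * (norm (y - z))\<^sup>2"
    using psd_nonneg[OF M, of "y - z"] T by simp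
  also have "\<dots> = y \<bullet> (M *v y) + T * (norm y)\<^sup>2 - 2 * (y \<bullet> (M *v z) + T * (y \<bullet> z)) + (z \<bullet> (M *v z) + T * (z \<bullet> z))"
    using psd_inner[OF M, of z y]
    by (simp add: matrix_vector_mult_diff_distrib inner_diff_left inner_diff_right power2_norm_eq_inner
        inner_commute algebra_simps)
  also have "y \<bullet> (M *v z) + T * (y \<bullet> z) = y \<bullet> X" by (simp add: z[symmetric] inner_add_right)
  also have "z \<bullet> (M *v z) + T * (z \<bullet> z) = z \<bullet> X" by (simp add: z[symmetric] inner_add_right)
  finally show ?thesis by simp
qed

text \<open>Pairs \<open>(n, k)\<close> stand for the \<open>k\<close>-th dyadic interval of length \<open>2\<^sup>-\<^sup>n\<close>, and \<open>j\<close> is the number of further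
  generations. The value is the sum over the leaves \<open>I\<close> of \<open>L\<close> at \<open>I\<close> times the square of the largest of
  \<open>c\<close> and the values of \<open>p\<close> at the ancestors of \<open>I\<close>: the squared \<open>L\<^sup>2\<close> norm of a truncated dyadic maximal
  function with respect to the measure \<open>L\<close>, with an initial value \<open>c\<close>.\<close>

fun tree_max_sum :: "(nat \<Rightarrow> nat \<Rightarrow> real) \<Rightarrow> (nat \<Rightarrow> nat \<Rightarrow> real) \<Rightarrow> nat \<Rightarrow> real \<Rightarrow> nat \<Rightarrow> nat \<Rightarrow> real" where
  "tree_max_sum L p 0 c n k = L n k * (max c (p n k))\<^sup>2"
| "tree_max_sum L p (Suc j) c n k =
     tree_max_sum L p j (max c (p n k)) (Suc n) (2 * k) + tree_max_sum L p j (max c (p n k)) (Suc n) (2 * k + 1)"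

text \<open>A Bellman function proof. Think of \<open>X\<close>, \<open>M\<close>, \<open>F\<close>, \<open>L\<close> as integrals over dyadic intervals of
  \<open>W\<^sup>1\<^sup>/\<^sup>2 f\<close>, \<open>W\<close>, the square of the norm of \<open>f\<close>, and a scalar minorant of \<open>W\<close>. The Bellman
  function is \<open>F - X \<bullet> (M + T)\<^sup>-\<^sup>1 X\<close>, where \<open>T \<le> L\<close> is the part of the \<open>L\<close>-mass of the interval
  whose maximum has already been realised inside the interval; the rest \<open>L - T\<close> still carries the
  value \<open>c\<close> inherited from above. When \<open>p\<close> exceeds \<open>c\<close> at a node, all remaining mass \<open>a\<close> is realised
  there, and the Bellman function at the node exceeds the sum of its values at the two children by at
  least \<open>a\<close> times the square of the norm of \<open>(M + T)\<^sup>-\<^sup>1 X\<close>, which is at least \<open>a p\<^sup>2 / 4\<close>.\<close>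

lemma matrix_maximal_tree:
  fixes X :: "nat \<Rightarrow> nat \<Rightarrow> complex^'n" and M :: "nat \<Rightarrow> nat \<Rightarrow> complex^'n^'n"
    and F L :: "nat \<Rightarrow> nat \<Rightarrow> real"
  assumes X: "\<And>n k. k < 2^n \<Longrightarrow> X n k = X (Suc n) (2 * k) + X (Suc n) (2 * k + 1)"
    and M: "\<And>n k. k < 2^n \<Longrightarrow> M n k = M (Suc n) (2 * k) + M (Suc n) (2 * k + 1)"
    and F: "\<And>n k. k < 2^n \<Longrightarrow> F n k = F (Suc n) (2 * k) + F (Suc n) (2 * k + 1)"
    and L: "\<And>n k. k < 2^n \<Longrightarrow> L n k = L (Suc n) (2 * k) + L (Suc n) (2 * k + 1)"
    and psdM: "\<And>n k. k < 2^n \<Longrightarrow> psd (M n k)"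
    and Lpos: "\<And>n k. k < 2^n \<Longrightarrow> 0 < L n k"
    and LM: "\<And>n k v. k < 2^n \<Longrightarrow> L n k * (norm v)\<^sup>2 \<le> v \<bullet> (M n k *v v)"
    and XF: "\<And>n k y. k < 2^n \<Longrightarrow> 2 * (y \<bullet> X n k) \<le> y \<bullet> (M n k *v y) + F n k"
    and p: "\<And>n k. k < 2^n \<Longrightarrow> p n k = norm (matrix_inv (M n k) *v X n k)"
  shows "tree_max_sum L p j 0 0 0 \<le> 4 * F 0 0"
proof -
  have main: "\<exists>T y. 0 \<le> T \<and> T \<le> L n k \<and> M n k *v y + T *\<^sub>R y = X n k \<and>
    tree_max_sum L p j c n k \<le> c\<^sup>2 * (L n k - T) + 4 * (F n k - y \<bullet> X n k)" if "k < 2^n" for j c n k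
    using that
  proof (induction j arbitrary: c n k)
    case 0
    note k = 0
    \<comment> \<open>At a leaf the maximum is realised here or was inherited.\<close>
    define T where "T = (if p n k > c then L n k else 0)"
    have T: "0 \<le> T" "T \<le> L n k" using Lpos[OF k] by (auto simp: T_def)
    obtain y where y: "M n k *v y + T *\<^sub>R y = X n k"
      using resolvent_exists[OF LM[OF k] Lpos[OF k] T(1)] by blast
    have py: "p n k \<le> 2 * norm y"
      unfolding p[OF k] by (rule resolvent_lower_bound[OF LM[OF k] Lpos[OF k] T y])
    have "y \<bullet> X n k = y \<bullet> (M n k *v y) + T * (norm y)\<^sup>2"
      by (simp add: y[symmetric] inner_add_right power2_norm_eq_inner)
    with XF[OF k, of y] have yX: "y \<bullet> X n k + T * (norm y)\<^sup>2 \<le> F n k" by simp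
    have "tree_max_sum L p 0 c n k \<le> c\<^sup>2 * (L n k - T) + 4 * (F n k - y \<bullet> X n k)"
    proof (cases "p n k > c")
      case True
      have "0 \<le> p n k" by (simp add: p[OF k])
      then have "(p n k)\<^sup>2 \<le> 4 * (norm y)\<^sup>2" using power_mono[OF py, of 2] by (simp add: power_mult_distrib)
      then have "L n k * (p n k)\<^sup>2 \<le> L n k * (4 * (norm y)\<^sup>2)" using Lpos[OF k] by (intro mult_left_mono) auto
      with yX True show ?thesis by (simp add: T_def max_def)
    next
      case False
      with yX show ?thesis by (simp add: T_def max_def mult.commute)
    qed
    with T y show ?case by blast
  next
    case (Suc j)
    note k = \<open>k < 2^n\<close>
    have k1: "2 * k < 2 ^ Suc n" and k2: "2 * k + 1 < 2 ^ Suc n" using k by auto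
    define d where "d = max c (p n k)"
    from Suc.IH[OF k1, of d] obtain T1 y1 where 1: "0 \<le> T1" "T1 \<le> L (Suc n) (2*k)"
      "M (Suc n) (2*k) *v y1 + T1 *\<^sub>R y1 = X (Suc n) (2*k)"
      "tree_max_sum L p j d (Suc n) (2*k) \<le> d\<^sup>2 * (L (Suc n) (2*k) - T1) + 4 * (F (Suc n) (2*k) - y1 \<bullet> X (Suc n) (2*k))"
      by blast
    from Suc.IH[OF k2, of d] obtain T2 y2 where 2: "0 \<le> T2" "T2 \<le> L (Suc n) (2*k+1)"
      "M (Suc n) (2*k+1) *v y2 + T2 *\<^sub>R y2 = X (Suc n) (2*k+1)"
      "tree_max_sum L p j d (Suc n) (2*k+1) \<le> d\<^sup>2 * (L (Suc n) (2*k+1) - T2) + 4 * (F (Suc n) (2*k+1) - y2 \<bullet> X (Suc n) (2*k+1))"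
      by blast
    \<comment> \<open>The mass not yet realised below is realised at this node if the value here exceeds the inherited one.\<close>
    define a where "a = (if p n k > c then L n k - (T1 + T2) else 0)"
    have a: "0 \<le> a" "T1 + T2 + a \<le> L n k" using 1(2) 2(2) L[OF k] by (auto simp: a_def)
    define T where "T = T1 + T2 + a"
    have T: "0 \<le> T" "T \<le> L n k" using a 1(1) 2(1) by (auto simp: T_def)
    obtain y where y: "M n k *v y + T *\<^sub>R y = X n k"
      using resolvent_exists[OF LM[OF k] Lpos[OF k] T(1)] by blast
    have py: "p n k \<le> 2 * norm y"
      unfolding p[OF k] by (rule resolvent_lower_bound[OF LM[OF k] Lpos[OF k] T y])
    have yX: "y \<bullet> X n k = y \<bullet> (M n k *v y) + T * (norm y)\<^sup>2"
      by (simp add: y[symmetric] inner_add_right power2_norm_eq_inner)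
    have "y \<bullet> (M n k *v y) = y \<bullet> (M (Suc n) (2*k) *v y) + y \<bullet> (M (Suc n) (2*k+1) *v y)"
      by (subst M[OF k]) (simp add: matrix_vector_mult_add_rdistrib inner_add_right)
    moreover have "y \<bullet> X n k = y \<bullet> X (Suc n) (2*k) + y \<bullet> X (Suc n) (2*k+1)"
      by (subst X[OF k]) (simp add: inner_add_right)
    ultimately have step: "y \<bullet> X n k + a * (norm y)\<^sup>2 \<le> y1 \<bullet> X (Suc n) (2*k) + y2 \<bullet> X (Suc n) (2*k+1)"
      using resolvent_variational[OF psdM[OF k1] 1(1) 1(3), of y]
        resolvent_variational[OF psdM[OF k2] 2(1) 2(3), of y] yX
      by (simp add: T_def algebra_simps)
    have ad: "a * d\<^sup>2 \<le> a * (4 * (norm y)\<^sup>2)"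
    proof (cases "p n k > c")
      case True
      have "0 \<le> p n k" by (simp add: p[OF k])
      then have "(p n k)\<^sup>2 \<le> 4 * (norm y)\<^sup>2" using power_mono[OF py, of 2] by (simp add: power_mult_distrib)
      then show ?thesis using True a(1) by (intro mult_left_mono) (auto simp: d_def max_def)
    qed (simp add: a_def)
    \<comment> \<open>If \<open>p n k \<le> c\<close>, then \<open>d = c\<close> and \<open>a = 0\<close>; otherwise \<open>L n k - T = 0\<close>.\<close>
    have dc: "d\<^sup>2 * (L n k - (T1 + T2)) = c\<^sup>2 * (L n k - T) + a * d\<^sup>2"
      by (auto simp: T_def a_def d_def max_def algebra_simps)
    have "tree_max_sum L p (Suc j) c n k \<le> d\<^sup>2 * (L n k - (T1 + T2)) + 4 * (F n k - (y1 \<bullet> X (Suc n) (2*k) + y2 \<bullet> X (Suc n) (2*k+1)))"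
      using 1(4) 2(4) unfolding tree_max_sum.simps d_def[symmetric] L[OF k] F[OF k]
      by (simp add: algebra_simps)
    also have "\<dots> \<le> c\<^sup>2 * (L n k - T) + 4 * (F n k - y \<bullet> X n k)"
      using step ad unfolding dc by (simp add: algebra_simps)
    finally show ?case using T y by blast
  qed
  obtain T y where T: "0 \<le> T" "M 0 0 *v y + T *\<^sub>R y = X 0 0" "tree_max_sum L p j 0 0 0 \<le> 0\<^sup>2 * (L 0 0 - T) + 4 * (F 0 0 - y \<bullet> X 0 0)"
    using main[of 0 0 j 0] by auto
  have "y \<bullet> X 0 0 = y \<bullet> (M 0 0 *v y) + T * (norm y)\<^sup>2"
    by (simp add: T(2)[symmetric] inner_add_right power2_norm_eq_inner)
  then have "0 \<le> y \<bullet> X 0 0" using psd_nonneg[OF psdM, of 0 0 y] T(1) by simp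
  with T(3) show ?thesis by simp
qed

fun tree_sum :: "(nat \<Rightarrow> nat \<Rightarrow> real) \<Rightarrow> nat \<Rightarrow> nat \<Rightarrow> nat \<Rightarrow> real" where
  "tree_sum a 0 n k = a n k"
| "tree_sum a (Suc j) n k = a n k + tree_sum a j (Suc n) (2 * k) + tree_sum a j (Suc n) (2 * k + 1)"

text \<open>A Carleson sequence sums against \<open>p q\<close> at most like \<open>C\<close> times the integral of the product of the
  maximal functions of \<open>p\<close> and \<open>q\<close>. The induction carries the running maxima \<open>c\<close>, \<open>d\<close> and the
  Carleson mass \<open>C I - tree_sum a\<close> that the subtree has not used up. At the leaves the product of the
  two maxima is split between the measures \<open>L\<close> and \<open>U\<close>.\<close>

lemma carleson_tree_bound:
  fixes a p q I L U :: "nat \<Rightarrow> nat \<Rightarrow> real"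
  assumes a: "\<And>n k. k < 2^n \<Longrightarrow> 0 \<le> a n k" 
    and car: "\<And>j n k. k < 2^n \<Longrightarrow> tree_sum a j n k \<le> C * I n k"
    and I: "\<And>n k. k < 2^n \<Longrightarrow> I n k = I (Suc n) (2 * k) + I (Suc n) (2 * k + 1)"
    and leaf: "\<And>n k c d. k < 2^n \<Longrightarrow> 0 \<le> c \<Longrightarrow> 0 \<le> d \<Longrightarrow> c * d * I n k \<le> D * (L n k * c\<^sup>2 + U n k * d\<^sup>2)"
    and p: "\<And>n k. 0 \<le> p n k" and q: "\<And>n k. 0 \<le> q n k" and C: "0 \<le> C"
  shows "tree_sum (\<lambda>n k. a n k * p n k * q n k) j 0 0 \<le> C * D * (tree_max_sum L p j 0 0 0 + tree_max_sum U q j 0 0 0)"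
proof -
  have main: "tree_sum (\<lambda>n k. a n k * p n k * q n k) j n k + c * d * (C * I n k - tree_sum a j n k)
      \<le> C * D * (tree_max_sum L p j c n k + tree_max_sum U q j d n k)"
    if "k < 2^n" "0 \<le> c" "0 \<le> d" for c d n k
    using that
  proof (induction j arbitrary: c d n k)
    case (0 c d n k)
    let ?c = "max c (p n k)" and ?d = "max d (q n k)"
    have cd: "0 \<le> ?c" "0 \<le> ?d" using 0 by auto
    have "a n k * (p n k * q n k) \<le> a n k * (?c * ?d)"
      using p q a[OF 0(1)] 0 by (intro mult_left_mono mult_mono) auto
    moreover have "c * d * (C * I n k - a n k) \<le> ?c * ?d * (C * I n k - a n k)"
      using car[OF 0(1), of 0] 0 by (intro mult_right_mono mult_mono) auto
    ultimately have "a n k * p n k * q n k + c * d * (C * I n k - a n k) \<le> C * (?c * ?d * I n k)"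
      by (simp add: algebra_simps)
    also have "\<dots> \<le> C * (D * (L n k * ?c\<^sup>2 + U n k * ?d\<^sup>2))"
      by (intro mult_left_mono leaf 0 cd C)
    finally show ?case by (simp add: mult.assoc)
  next
    case (Suc j c d n k)
    note k = \<open>k < 2^n\<close>
    have k1: "2 * k < 2 ^ Suc n" and k2: "2 * k + 1 < 2 ^ Suc n" using k by auto
    let ?c = "max c (p n k)" and ?d = "max d (q n k)"
    have cd: "0 \<le> ?c" "0 \<le> ?d" using Suc by auto
    have "a n k * (p n k * q n k) \<le> a n k * (?c * ?d)"
      using p q a[OF k] Suc by (intro mult_left_mono mult_mono) auto
    moreover have "c * d * (C * I n k - tree_sum a (Suc j) n k) \<le> ?c * ?d * (C * I n k - tree_sum a (Suc j) n k)"
      using car[OF k, of "Suc j"] Suc.prems by (intro mult_right_mono mult_mono) auto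
    moreover have "?c * ?d * (C * I n k) = ?c * ?d * (C * I (Suc n) (2*k)) + ?c * ?d * (C * I (Suc n) (2*k+1))"
      by (subst I[OF k]) (simp only: distrib_left)
    ultimately show ?case
      using Suc.IH[OF k1 cd] Suc.IH[OF k2 cd]
      by (simp add: algebra_simps)
  qed
  show ?thesis using main[of 0 0 0 0] by simp
qed

text \<open>The choice \<open>t = sqrt (G / F)\<close>; if \<open>F\<close> or \<open>G\<close> vanishes, \<open>t\<close> tends to infinity or to zero.\<close>

lemma le_two_sqrt:
  fixes s F G :: real
  assumes "\<And>t. 0 < t \<Longrightarrow> s \<le> t * F + G / t" "0 \<le> F" "0 \<le> G"
  shows "s \<le> 2 * sqrt F * sqrt G"
proof (cases "F = 0 \<or> G = 0")
  case False
  then have FG: "0 < F" "0 < G" using assms by auto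
  define f g where "f = sqrt F" and "g = sqrt G"
  have fg: "F = f * f" "G = g * g" "0 < f" "0 < g" using FG by (auto simp: f_def g_def)
  have "s \<le> g / f * (f * f) + g * g / (g / f)"
    using assms(1)[of "g / f"] fg by simp
  also have "\<dots> = 2 * f * g" using fg(3,4) by (simp add: field_simps)
  finally show ?thesis by (simp add: f_def g_def)
next
  case True
  have "s \<le> 0"
  proof (rule ccontr)
    assume "\<not> s \<le> 0"
    then have s: "0 < s" by simp
    from True show False
    proof
      assume "F = 0"
      with assms(1)[of "(G + 1) / s"] assms(3) s show False by (simp add: field_simps)
    next
      assume "G = 0"
      with assms(1)[of "s / (F + 1)"] assms(2) s show False by (simp add: field_simps)
    qed
  qed
  with True show ?thesis by auto
qed

section \<open>Dyadic intervals\<close>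

definition dyadic_ivl :: "nat \<Rightarrow> nat \<Rightarrow> real set" where
  "dyadic_ivl n k = {real k / 2 ^ n .. (real k + 1) / 2 ^ n}"

lemma dyadic_iff: "Q \<in> dyadic \<longleftrightarrow> (\<exists>n k. k < 2 ^ n \<and> Q = dyadic_ivl n k)"
  by (auto simp: dyadic_def dyadic_ivl_def)

lemma dyadic_ivl_in_dyadic: "k < 2 ^ n \<Longrightarrow> dyadic_ivl n k \<in> dyadic"
  by (auto simp: dyadic_iff)

lemma real_Suc_le_pow: assumes "k < (2::nat) ^ n" shows "real k + 1 \<le> 2 ^ n"
proof -
  have "real (Suc k) \<le> real (2 ^ n)" using assms by (intro of_nat_mono) simp
  then show ?thesis by simp
qed

lemma dyadic_ivl_subset_unit: "k < 2 ^ n \<Longrightarrow> dyadic_ivl n k \<subseteq> {0..1}"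
  using real_Suc_le_pow[of k n] by (auto simp: dyadic_ivl_def field_simps intro: order_trans)

lemma dyadic_in_unit: "dyadic_in {0..1} = dyadic"
  using dyadic_ivl_subset_unit unfolding dyadic_in_def by (auto simp only: dyadic_iff mem_Collect_eq) blast+

lemma dyadic_ivl_0: "dyadic_ivl 0 0 = {0..1}" by (simp add: dyadic_ivl_def)

lemma measure_dyadic_ivl: "measure lebesgue (dyadic_ivl n k) = 1 / 2 ^ n"
  by (simp add: dyadic_ivl_def divide_right_mono) (simp add: field_simps)

lemma dyadic_ivl_child0: "dyadic_ivl (Suc n) (2 * k) = {real k / 2 ^ n .. (2 * real k + 1) / 2 ^ Suc n}"
  by (simp add: dyadic_ivl_def)

lemma dyadic_ivl_child1: "dyadic_ivl (Suc n) (2 * k + 1) = {(2 * real k + 1) / 2 ^ Suc n .. (real k + 1) / 2 ^ n}"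
  by (simp add: dyadic_ivl_def field_simps)

lemma dyadic_ivl_mid: "real k / 2 ^ n \<le> (2 * real k + 1) / 2 ^ Suc n" "(2 * real k + 1) / 2 ^ Suc n \<le> (real k + 1) / 2 ^ n"
  by (simp_all add: field_simps)

lemma dyadic_ivl_children_subset: "dyadic_ivl (Suc n) (2 * k) \<subseteq> dyadic_ivl n k" "dyadic_ivl (Suc n) (2 * k + 1) \<subseteq> dyadic_ivl n k"
  using dyadic_ivl_mid[of k n] unfolding dyadic_ivl_child0 dyadic_ivl_child1 dyadic_ivl_def[of n k] by auto

fun dyadic_subtree :: "nat \<Rightarrow> nat \<Rightarrow> nat \<Rightarrow> real set set" where
  "dyadic_subtree 0 n k = {dyadic_ivl n k}"
| "dyadic_subtree (Suc j) n k = insert (dyadic_ivl n k) (dyadic_subtree j (Suc n) (2 * k) \<union> dyadic_subtree j (Suc n) (2 * k + 1))"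

lemma finite_dyadic_subtree [simp]: "finite (dyadic_subtree j n k)"
  by (induction j arbitrary: n k) auto

lemma dyadic_subtree_props:
  "Q \<in> dyadic_subtree j n k \<Longrightarrow> Q \<subseteq> dyadic_ivl n k \<and> 0 < measure lebesgue Q \<and> measure lebesgue Q \<le> 1 / 2 ^ n"
proof (induction j arbitrary: n k)
  case 0
  then show ?case by (auto simp: measure_dyadic_ivl)
next
  case (Suc j)
  have le: "1 / 2 ^ Suc n \<le> (1 / 2 ^ n :: real)" by (simp add: field_simps)
  consider "Q = dyadic_ivl n k" | "Q \<in> dyadic_subtree j (Suc n) (2 * k)" | "Q \<in> dyadic_subtree j (Suc n) (2 * k + 1)" using Suc.prems by auto
  then show ?case
  proof cases
    case 1
    then show ?thesis by (auto simp: measure_dyadic_ivl)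
  next
    case 2
    from Suc.IH[OF 2] le dyadic_ivl_children_subset(1)[of n k] show ?thesis by (meson order_trans)
  next
    case 3
    from Suc.IH[OF 3] le dyadic_ivl_children_subset(2)[of n k] show ?thesis by (meson order_trans)
  qed
qed

lemma dyadic_subtree_dyadic: "Q \<in> dyadic_subtree j n k \<Longrightarrow> k < 2 ^ n \<Longrightarrow> Q \<in> dyadic"
proof (induction j arbitrary: n k)
  case (Suc j)
  have "2 * k < 2 ^ Suc n" "2 * k + 1 < 2 ^ Suc n" using Suc.prems(2) by auto
  with Suc show ?case by (auto simp: dyadic_ivl_in_dyadic)
qed (auto simp: dyadic_ivl_in_dyadic)

text \<open>The recursive sum counts no interval twice: a proper descendant is shorter than its ancestor, and
  intervals from the two halves share at most the midpoint.\<close>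

lemma tree_sum_dyadic_subtree: "tree_sum (\<lambda>n k. \<phi> (dyadic_ivl n k)) j n k = (\<Sum>Q\<in>dyadic_subtree j n k. \<phi> Q)"
proof (induction j arbitrary: n k)
  case (Suc j)
  let ?A = "dyadic_subtree j (Suc n) (2 * k)" and ?B = "dyadic_subtree j (Suc n) (2 * k + 1)"
  have small: "1 / 2 ^ Suc n < (1 / 2 ^ n :: real)" by (simp add: field_simps)
  have nin: "dyadic_ivl n k \<notin> ?A \<union> ?B"
  proof
    assume "dyadic_ivl n k \<in> ?A \<union> ?B"
    then have "measure lebesgue (dyadic_ivl n k) \<le> 1 / 2 ^ Suc n"
      using dyadic_subtree_props by blast
    with small show False unfolding measure_dyadic_ivl by linarith
  qed
  have disj: "?A \<inter> ?B = {}"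
  proof (rule ccontr)
    assume "?A \<inter> ?B \<noteq> {}"
    then obtain Q where Q: "Q \<in> ?A" "Q \<in> ?B" by blast
    let ?m = "(2 * real k + 1) / 2 ^ Suc n"
    have "Q \<subseteq> dyadic_ivl (Suc n) (2 * k) \<inter> dyadic_ivl (Suc n) (2 * k + 1)" using dyadic_subtree_props Q by blast
    also have "\<dots> \<subseteq> {?m}" unfolding dyadic_ivl_child0 dyadic_ivl_child1 by auto
    finally have "Q = {} \<or> Q = {?m}" by blast
    then have "measure lebesgue Q = 0" by auto
    then show False using dyadic_subtree_props[OF Q(1)] by simp
  qed
  show ?case using Suc nin disj by (simp add: sum.union_disjoint)
qed simp

lemma dyadic_ivl_in_dyadic_subtree: "i \<le> j \<Longrightarrow> r div 2 ^ i = k \<Longrightarrow> dyadic_ivl (n + i) r \<in> dyadic_subtree j n k"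
proof (induction j arbitrary: i n k)
  case (Suc j)
  show ?case
  proof (cases i)
    case (Suc i')
    have "(r div 2 ^ i') div 2 = k" using Suc.prems(2) \<open>i = Suc i'\<close>
      by (metis div_mult2_eq power_Suc2)
    moreover have "x = 2 * k \<or> x = 2 * k + 1" if "x div 2 = k" for x :: nat using that by presburger
    ultimately have "r div 2 ^ i' = 2 * k \<or> r div 2 ^ i' = 2 * k + 1" by blast
    then show ?thesis
      using Suc.IH[of i' "2 * k" "Suc n"] Suc.IH[of i' "2 * k + 1" "Suc n"] Suc.prems(1) \<open>i = Suc i'\<close> by auto
  qed (use Suc.prems in auto)
qed auto

lemma finite_dyadic_in_dyadic_subtree:
  assumes "finite F" "F \<subseteq> dyadic" shows "\<exists>N. F \<subseteq> dyadic_subtree N 0 0"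
proof -
  have "\<forall>Q\<in>F. \<exists>n k. k < 2 ^ n \<and> Q = dyadic_ivl n k" using assms(2) by (auto simp: dyadic_iff)
  then obtain lev where lev: "\<And>Q. Q \<in> F \<Longrightarrow> \<exists>k. k < 2 ^ lev Q \<and> Q = dyadic_ivl (lev Q) k" by metis
  have "Q \<in> dyadic_subtree (Max (lev ` F)) 0 0" if "Q \<in> F" for Q
  proof -
    obtain k where k: "k < 2 ^ lev Q" "Q = dyadic_ivl (lev Q) k" using lev[OF \<open>Q \<in> F\<close>] by blast
    have "lev Q \<le> Max (lev ` F)" using assms(1) that by simp
    from dyadic_ivl_in_dyadic_subtree[OF this, of k 0 0] k show ?thesis by simp
  qed
  then show ?thesis by blast
qed

lemma infsum_dyadic_le:
  fixes \<phi> :: "real set \<Rightarrow> real"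
  assumes nonneg: "\<And>Q. 0 \<le> \<phi> Q" and le: "\<And>N. tree_sum (\<lambda>n k. \<phi> (dyadic_ivl n k)) N 0 0 \<le> B"
  shows "(\<Sum>\<^sub>\<infinity>Q\<in>dyadic. ennreal (\<phi> Q)) \<le> ennreal B"
proof (rule infsum_le_finite_sums)
  show "(\<lambda>Q. ennreal (\<phi> Q)) summable_on dyadic"
    by (intro nonneg_summable_on_complete) simp
  fix F assume F: "finite F" "F \<subseteq> dyadic"
  then obtain N where N: "F \<subseteq> dyadic_subtree N 0 0" using finite_dyadic_in_dyadic_subtree by blast
  have "(\<Sum>Q\<in>F. ennreal (\<phi> Q)) = ennreal (\<Sum>Q\<in>F. \<phi> Q)" using nonneg by simp
  also have "\<dots> \<le> ennreal (\<Sum>Q\<in>dyadic_subtree N 0 0. \<phi> Q)"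
    using N nonneg by (intro ennreal_leI sum_mono2) auto
  also have "\<dots> \<le> ennreal B" using le[of N] by (intro ennreal_leI) (simp add: tree_sum_dyadic_subtree)
  finally show "(\<Sum>Q\<in>F. ennreal (\<phi> Q)) \<le> ennreal B" .
qed

lemma sets_lebesgue_dyadic_ivl [measurable]: "dyadic_ivl n k \<in> sets lebesgue" by (simp add: dyadic_ivl_def)

lemma integrable_dyadic_ivl:
  fixes h :: "real \<Rightarrow> 'a::euclidean_space"
  assumes "integrable (lebesgue_on {0..1}) h" "k < 2 ^ n"
  shows "integrable (lebesgue_on (dyadic_ivl n k)) h"
  using integrable_subinterval[OF assms(1)] dyadic_ivl_subset_unit[OF assms(2)] unfolding dyadic_ivl_def by blast

lemma integral_dyadic_ivl_split:
  fixes h :: "real \<Rightarrow> 'a::euclidean_space"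
  assumes "integrable (lebesgue_on {0..1}) h" "k < 2 ^ n"
  shows "integral\<^sup>L (lebesgue_on (dyadic_ivl n k)) h =
    integral\<^sup>L (lebesgue_on (dyadic_ivl (Suc n) (2 * k))) h + integral\<^sup>L (lebesgue_on (dyadic_ivl (Suc n) (2 * k + 1))) h"
  using integral_combine[OF integrable_dyadic_ivl[OF assms, unfolded dyadic_ivl_def] dyadic_ivl_mid[of k n]]
  unfolding dyadic_ivl_child0 dyadic_ivl_child1 unfolding dyadic_ivl_def .

lemma AE_dyadic_ivl:
  assumes "AE x in lebesgue_on {0..1}. P x" "k < 2 ^ n"
  shows "AE x in lebesgue_on (dyadic_ivl n k). P x"
proof -
  have "AE x in lebesgue. x \<in> {0..1} \<longrightarrow> P x" using assms(1) by (simp add: AE_restrict_space_iff)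
  then have "AE x in lebesgue. x \<in> dyadic_ivl n k \<longrightarrow> P x"
    by (rule eventually_mono) (use dyadic_ivl_subset_unit[OF assms(2)] in blast)
  then show ?thesis by (simp add: AE_restrict_space_iff sets_lebesgue_dyadic_ivl)
qed

lemma avg_dyadic_ivl: "avg (dyadic_ivl n k) h = 2 ^ n *\<^sub>R integral\<^sup>L (lebesgue_on (dyadic_ivl n k)) h"
  by (simp add: avg_def measure_dyadic_ivl)

lemma integral_dyadic_ivl_const: "integral\<^sup>L (lebesgue_on (dyadic_ivl n k)) (\<lambda>x. c :: real) = c / 2 ^ n"
  by (simp add: measure_restrict_space measure_dyadic_ivl)

text \<open>The Frobenius norm of the square root of \<open>A\<close> has the square \<open>tr A\<close>.\<close>

lemma psd_trace_bound:
  fixes A :: "complex^'n^'n"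
  assumes A: "psd A"
  shows "v \<bullet> (A *v v) \<le> Re (trace A) * (norm v)\<^sup>2"
proof -
  let ?B = "msqrt A"
  have L2: "(norm u)\<^sup>2 = (\<Sum>i\<in>UNIV. (norm (u $ i))\<^sup>2)" for u :: "('b::real_normed_vector)^'n"
    by (simp add: norm_vec_def L2_set_def sum_nonneg)
  have "(norm ?B)\<^sup>2 = (\<Sum>i\<in>UNIV. \<Sum>j\<in>UNIV. (norm (?B $ i $ j))\<^sup>2)"
    by (simp add: L2)
  also have "\<dots> = (\<Sum>j\<in>UNIV. \<Sum>i\<in>UNIV. (norm (?B $ i $ j))\<^sup>2)" by (rule sum.swap)
  also have "\<dots> = (\<Sum>j\<in>UNIV. (norm (?B *v axis j 1))\<^sup>2)"
    by (simp add: L2 mv_axis)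
  also have "\<dots> = Re (trace A)" by (simp add: norm_msqrt[OF A] Re_trace)
  finally have tr: "(norm ?B)\<^sup>2 = Re (trace A)" .
  have "v \<bullet> (A *v v) = (norm (?B *v v))\<^sup>2" by (simp add: norm_msqrt[OF A])
  also have "\<dots> \<le> (norm ?B * norm v)\<^sup>2" by (intro power_mono norm_mv norm_ge_zero)
  finally show ?thesis by (simp add: power_mult_distrib tr)
qed

lemma psd_trace_nonneg: "psd A \<Longrightarrow> 0 \<le> Re (trace A)"
  unfolding Re_trace by (intro sum_nonneg psd_nonneg)

lemma bounded_linear_Re_trace: "bounded_linear (\<lambda>A::complex^'n^'n. Re (trace A))"
  unfolding trace_def Re_sum
  by (intro bounded_linear_sum bounded_linear_compose[OF bounded_linear_Re]
      bounded_linear_compose[OF bounded_linear_vec_nth] bounded_linear_vec_nth)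

text \<open>Taking traces turns the matrix Carleson condition into a scalar one, at the price of the factor
  \<open>CARD('n)\<close>.\<close>

lemma carleson_trace:
  fixes A :: "real set \<Rightarrow> complex^'n^'n"
  assumes car: "carleson C A" and k: "k < 2 ^ n"
  shows "tree_sum (\<lambda>n k. Re (trace (A (dyadic_ivl n k)))) j n k \<le> real CARD('n) * C * (1 / 2 ^ n)"
proof -
  let ?K = "dyadic_ivl n k" and ?tr = "\<lambda>M::complex^'n^'n. Re (trace M)"
  have K: "?K \<in> dyadic" by (rule dyadic_ivl_in_dyadic[OF k])
  have psdA: "psd (A Q)" if "Q \<in> dyadic" for Q using car that by (simp add: carleson_def)
  have sm: "A summable_on dyadic_in ?K" and
    le: "(1 / measure lebesgue ?K) *\<^sub>R (\<Sum>\<^sub>\<infinity>Q\<in>dyadic_in ?K. A Q) \<preceq> C *\<^sub>R mat 1"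
    using car K by (auto simp: carleson_def)
  have hs: "((\<lambda>Q. ?tr (A Q)) has_sum ?tr (\<Sum>\<^sub>\<infinity>Q\<in>dyadic_in ?K. A Q)) (dyadic_in ?K)"
    using has_sum_bounded_linear[OF bounded_linear_Re_trace has_sum_infsum[OF sm]] by (simp add: o_def)
  have "tree_sum (\<lambda>n k. ?tr (A (dyadic_ivl n k))) j n k = (\<Sum>Q\<in>dyadic_subtree j n k. ?tr (A Q))"
    by (rule tree_sum_dyadic_subtree)
  also have "\<dots> \<le> ?tr (\<Sum>\<^sub>\<infinity>Q\<in>dyadic_in ?K. A Q)"
  proof (rule has_sum_mono2[OF has_sum_finite hs])
    show "dyadic_subtree j n k \<subseteq> dyadic_in ?K"
      using dyadic_subtree_props dyadic_subtree_dyadic k unfolding dyadic_in_def by blast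
    show "0 \<le> ?tr (A Q)" if "Q \<in> dyadic_in ?K - dyadic_subtree j n k" for Q
      using that psdA psd_trace_nonneg by (auto simp: dyadic_in_def)
  qed simp
  also have "\<dots> \<le> real CARD('n) * C * (1 / 2 ^ n)"
  proof -
    have "0 \<le> ?tr (C *\<^sub>R mat 1 - 2 ^ n *\<^sub>R (\<Sum>\<^sub>\<infinity>Q\<in>dyadic_in ?K. A Q))"
      using le by (intro psd_trace_nonneg) (simp add: loewner_le_def measure_dyadic_ivl)
    also have "\<dots> = C * real CARD('n) - 2 ^ n * ?tr (\<Sum>\<^sub>\<infinity>Q\<in>dyadic_in ?K. A Q)"
      by (simp add: linear_diff[OF bounded_linear.linear[OF bounded_linear_Re_trace]]
          linear_scale[OF bounded_linear.linear[OF bounded_linear_Re_trace]] trace_I)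
    finally show ?thesis by (simp add: field_simps)
  qed
  finally show ?thesis .
qed

section \<open>Matrix weights and their maximal function\<close>

lemma borel_measurable_lebesgue_on_AE:
  fixes f g :: "real \<Rightarrow> 'b::euclidean_space"
  assumes f: "f \<in> borel_measurable (lebesgue_on S)" and S: "S \<in> sets lebesgue"
    and eq: "AE x in lebesgue_on S. f x = g x"
  shows "g \<in> borel_measurable (lebesgue_on S)"
proof -
  have "(\<lambda>x. if x \<in> S then f x else 0) \<in> borel_measurable lebesgue"
    using f S by (simp add: borel_measurable_if)
  moreover have "AE x in lebesgue. (if x \<in> S then f x else 0) = (if x \<in> S then g x else 0)"
    using eq S by (simp add: AE_restrict_space_iff)
  ultimately have "(\<lambda>x. if x \<in> S then g x else 0) \<in> borel_measurable lebesgue"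
    by (rule borel_measurable_AE)
  then show ?thesis using S by (simp add: borel_measurable_if)
qed

text \<open>The square root is a limit of continuous functions of the matrix on the positive semidefinite
  matrices; the unspecified values elsewhere only occur on a null set, and Lebesgue measure is
  complete.\<close>

lemma borel_measurable_msqrt:
  fixes W :: "real \<Rightarrow> complex^'n^'n"
  assumes W: "W \<in> borel_measurable (lebesgue_on S)" and S: "S \<in> sets lebesgue"
    and psd: "AE x in lebesgue_on S. psd (W x)"
  shows "(\<lambda>x. msqrt (W x)) \<in> borel_measurable (lebesgue_on S)"
proof (rule borel_measurable_lebesgue_on_AE[OF _ S])
  show "(\<lambda>x. lim (\<lambda>n. msqrt_approx n (W x))) \<in> borel_measurable (lebesgue_on S)"
    by (intro borel_measurable_lim_metric measurable_compose[OF W borel_measurable_msqrt_approx])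
  show "AE x in lebesgue_on S. lim (\<lambda>n. msqrt_approx n (W x)) = msqrt (W x)"
    using psd by (rule eventually_mono) (rule limI, rule msqrt_limit)
qed

lemma borel_measurable_mv:
  fixes W :: "real \<Rightarrow> complex^'n^'n" and f :: "real \<Rightarrow> complex^'n"
  assumes "W \<in> borel_measurable M" "f \<in> borel_measurable M"
  shows "(\<lambda>x. W x *v f x) \<in> borel_measurable M"
proof (rule borel_measurable_continuous_Pair[OF assms])
  show "continuous_on UNIV (\<lambda>x::(complex^'n^'n) \<times> (complex^'n). fst x *v snd x)"
    by (intro bounded_bilinear.continuous_on[OF bounded_bilinear_mv] continuous_on_fst continuous_on_snd continuous_on_id)
qed

text \<open>The real part of the form determines the matrix entries: testing with \<open>axis i 1\<close> gives the real
  parts, with \<open>axis i \<i>\<close> the imaginary parts.\<close>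

lemma hermitianI_inner:
  fixes A :: "complex^'n^'n"
  assumes "\<And>x y. x \<bullet> (A *v y) = (A *v x) \<bullet> y"
  shows "hermitian A"
  unfolding hermitian_def
proof (intro allI)
  fix i j
  have sc: "A *v axis k c = (\<chi> l. A $ l $ k * c)" for k c
    by (simp add: vec_eq_iff matrix_vector_mult_def axis_def if_distrib cong: if_cong)
  have "axis i c \<bullet> (A *v axis j 1) = (A *v axis i c) \<bullet> axis j 1" for c by (rule assms)
  then have "c \<bullet> (A $ i $ j) = (A $ j $ i * c) \<bullet> 1" for c
    by (simp add: inner_axis inner_axis' sc)
  from this[of 1] this[of \<i>] show "A $ i $ j = cnj (A $ j $ i)"
    by (simp add: complex_eq_iff inner_complex_def)
qed

lemma psd_matrix_inv:
  fixes A :: "complex^'n^'n"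
  assumes "psd A" "invertible A"
  shows "psd (matrix_inv A)" "invertible (matrix_inv A)" "matrix_inv (matrix_inv A) = A"
proof -
  let ?B = "matrix_inv A"
  have 1: "x \<bullet> (?B *v y) = (?B *v x) \<bullet> y" for x y
    using psd_inner[OF assms(1), of "?B *v x" "?B *v y"] by (simp add: matrix_inv_cancel[OF assms(2)] del: matrix_vector_mul_assoc)
  have 2: "0 \<le> x \<bullet> (?B *v x)" for x
    using psd_nonneg[OF assms(1), of "?B *v x"] by (simp add: matrix_inv_cancel[OF assms(2)] inner_commute del: matrix_vector_mul_assoc)
  show "psd ?B" using 2 hermitianI_inner[OF 1] by (simp add: psd_iff_inner)
  show inv: "invertible ?B" unfolding invertible_def using matrix_inv_mult[OF assms(2)] by blast
  show "matrix_inv ?B = A"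
    using matrix_inv_mult[OF inv] matrix_inv_mult[OF assms(2)]
    by (metis matrix_mul_assoc matrix_mul_lid matrix_mul_rid)
qed

text \<open>The reciprocal of the norm of \<open>A\<^sup>-\<^sup>1\<close> is a scalar minorant of \<open>A\<close>. The Frobenius norm is used instead
  of the smallest eigenvalue because it is evidently measurable; this costs powers of the dimension
  only. The proof applies Cauchy--Schwarz for \<open>A\<close> to \<open>A\<^sup>-\<^sup>1 v\<close> and \<open>v\<close>.\<close>

lemma psd_lower_bound:
  fixes A :: "complex^'n^'n"
  assumes "psd A" "invertible A"
  shows "(norm v)\<^sup>2 \<le> norm (matrix_inv A) * (v \<bullet> (A *v v))"
proof (cases "v = 0")
  case False
  let ?u = "matrix_inv A *v v"
  have Au: "A *v ?u = v" by (rule matrix_inv_cancel[OF assms(2)])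
  have "((norm v)\<^sup>2)\<^sup>2 = (?u \<bullet> (A *v v))\<^sup>2"
    by (simp add: psd_inner[OF assms(1)] Au power2_norm_eq_inner del: matrix_vector_mul_assoc)
  also have "\<dots> \<le> (?u \<bullet> (A *v ?u)) * (v \<bullet> (A *v v))" by (rule psd_Cauchy_Schwarz[OF assms(1)])
  also have "?u \<bullet> (A *v ?u) = v \<bullet> (matrix_inv A *v v)" by (simp only: Au inner_commute)
  also have "\<dots> * (v \<bullet> (A *v v)) \<le> (norm (matrix_inv A) * (norm v)\<^sup>2) * (v \<bullet> (A *v v))"
    by (intro mult_right_mono inner_mv_le_norm psd_nonneg assms)
  finally have "(norm v)\<^sup>2 * (norm v)\<^sup>2 \<le> (norm v)\<^sup>2 * (norm (matrix_inv A) * (v \<bullet> (A *v v)))"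
    by (simp add: power2_eq_square algebra_simps)
  moreover have "0 < (norm v)\<^sup>2" using False by simp
  ultimately show ?thesis by (simp only: mult_le_cancel_left_pos)
qed simp

lemma norm_matrix_inv:
  fixes A :: "complex^'n^'n"
  assumes "psd A" "invertible A"
  shows "0 < norm (matrix_inv A)" "1 / norm (matrix_inv A) \<le> norm A"
proof -
  let ?e = "axis undefined 1 :: complex^'n"
  have "1 \<le> norm (matrix_inv A) * (?e \<bullet> (A *v ?e))"
    using psd_lower_bound[OF assms, of ?e] by (simp add: norm_axis_complex)
  also have "\<dots> \<le> norm (matrix_inv A) * norm A"
    using inner_mv_le_norm[of ?e A] by (intro mult_left_mono) (simp_all add: norm_axis_complex)
  finally have 1: "1 \<le> norm (matrix_inv A) * norm A" .
  then show 0: "0 < norm (matrix_inv A)"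
    by (smt (verit) mult_eq_0_iff norm_ge_zero)
  show "1 / norm (matrix_inv A) \<le> norm A"
    using 1 0 by (simp add: field_simps)
qed

lemma matrix_weightD:
  fixes W :: "real \<Rightarrow> complex^'n^'n"
  assumes "matrix_weight W"
  shows "AE x in lebesgue_on {0..1}. psd (W x) \<and> invertible (W x)"
    "integrable (lebesgue_on {0..1}) W" "integrable (lebesgue_on {0..1}) (\<lambda>x. matrix_inv (W x))"
  using assms by (auto simp: matrix_weight_def)

lemma matrix_weight_inv:
  fixes W :: "real \<Rightarrow> complex^'n^'n"
  assumes "matrix_weight W"
  shows "matrix_weight (\<lambda>x. matrix_inv (W x))"
  unfolding matrix_weight_def
proof (intro conjI)
  note W = matrix_weightD[OF assms]
  show "AE x in lebesgue_on {0..1}. psd (matrix_inv (W x)) \<and> invertible (matrix_inv (W x))"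
    using W(1) by (rule eventually_mono) (auto intro: psd_matrix_inv)
  have eq: "AE x in lebesgue_on {0..1}. W x = matrix_inv (matrix_inv (W x))"
    using W(1) by (rule eventually_mono) (auto simp: psd_matrix_inv)
  then have "(\<lambda>x. matrix_inv (matrix_inv (W x))) \<in> borel_measurable (lebesgue_on {0..1})"
    using W(2) by (intro borel_measurable_lebesgue_on_AE[OF _ _ eq]) auto
  then show "integrable (lebesgue_on {0..1}) (\<lambda>x. matrix_inv (matrix_inv (W x)))"
    using W(2) integrable_cong_AE[OF _ _ eq] by auto
qed (use matrix_weightD[OF assms] in auto)

lemma integral_inner_mv:
  fixes W :: "real \<Rightarrow> complex^'n^'n"
  assumes "integrable M W"
  shows "x \<bullet> (integral\<^sup>L M W *v y) = integral\<^sup>L M (\<lambda>t. x \<bullet> (W t *v y))"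
    "integrable M (\<lambda>t. x \<bullet> (W t *v y))"
proof -
  have bl: "bounded_linear (\<lambda>A::complex^'n^'n. x \<bullet> (A *v y))"
    by (intro bounded_linear_compose[OF bounded_linear_inner_right] bounded_bilinear.bounded_linear_left[OF bounded_bilinear_mv])
  show "x \<bullet> (integral\<^sup>L M W *v y) = integral\<^sup>L M (\<lambda>t. x \<bullet> (W t *v y))"
    using integral_bounded_linear[OF bl assms] by simp
  show "integrable M (\<lambda>t. x \<bullet> (W t *v y))"
    using integrable_bounded_linear[OF bl assms] .
qed

lemma psd_integral:
  fixes W :: "real \<Rightarrow> complex^'n^'n"
  assumes W: "integrable M W" and psd: "AE x in M. psd (W x)"
  shows "psd (integral\<^sup>L M W)"
  unfolding psd_iff_inner
proof (intro conjI allI hermitianI_inner)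
  fix x y :: "complex^'n"
  have "x \<bullet> (integral\<^sup>L M W *v y) = integral\<^sup>L M (\<lambda>t. x \<bullet> (W t *v y))" by (rule integral_inner_mv[OF W])
  also have "\<dots> = integral\<^sup>L M (\<lambda>t. y \<bullet> (W t *v x))"
  proof (rule integral_cong_AE)
    show "AE t in M. x \<bullet> (W t *v y) = y \<bullet> (W t *v x)"
      using psd by (rule eventually_mono) (metis psd_inner inner_commute)
  qed (use integral_inner_mv(2)[OF W] in auto)
  also have "\<dots> = y \<bullet> (integral\<^sup>L M W *v x)" by (rule integral_inner_mv(1)[OF W, symmetric])
  finally show "x \<bullet> (integral\<^sup>L M W *v y) = (integral\<^sup>L M W *v x) \<bullet> y" by (simp add: inner_commute)
next
  fix x :: "complex^'n"
  show "0 \<le> x \<bullet> (integral\<^sup>L M W *v x)"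
    unfolding integral_inner_mv(1)[OF W]
    by (intro integral_nonneg_AE eventually_mono[OF psd]) (rule psd_nonneg)
qed

lemma integrable_sqrt_weight:
  fixes W :: "real \<Rightarrow> complex^'n^'n"
  assumes W: "matrix_weight W" and f: "f \<in> L2"
  shows "integrable (lebesgue_on {0..1}) (\<lambda>x. msqrt (W x) *v f x)"
proof (rule Bochner_Integration.integrable_bound)
  note W = matrix_weightD[OF W]
  have f: "f \<in> borel_measurable (lebesgue_on {0..1})" "integrable (lebesgue_on {0..1}) (\<lambda>x. (norm (f x))\<^sup>2)"
    using f by (auto simp: L2_def)
  show "integrable (lebesgue_on {0..1}) (\<lambda>x. norm (W x) + (norm (f x))\<^sup>2)"
    using W f by auto
  have psd: "AE x in lebesgue_on {0..1}. psd (W x)" using W(1) by (rule eventually_mono) simp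
  show "(\<lambda>x. msqrt (W x) *v f x) \<in> borel_measurable (lebesgue_on {0..1})"
    using W(2) psd f by (intro borel_measurable_mv borel_measurable_msqrt) auto
  show "AE x in lebesgue_on {0..1}. norm (msqrt (W x) *v f x) \<le> norm (norm (W x) + (norm (f x))\<^sup>2)"
    using psd
  proof (rule eventually_mono)
    fix x assume x: "psd (W x)"
    have "(norm (msqrt (W x) *v f x))\<^sup>2 \<le> norm (W x) * (norm (f x))\<^sup>2"
      unfolding norm_msqrt[OF x] by (rule inner_mv_le_norm)
    also have "\<dots> \<le> (norm (W x) + (norm (f x))\<^sup>2)\<^sup>2"
      by (simp add: power2_sum)
    finally have "norm (msqrt (W x) *v f x) \<le> norm (W x) + (norm (f x))\<^sup>2"
      by (rule power2_le_imp_le) simp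
    then show "norm (msqrt (W x) *v f x) \<le> norm (norm (W x) + (norm (f x))\<^sup>2)" by simp
  qed
qed

lemma integrable_lower:
  fixes W :: "real \<Rightarrow> complex^'n^'n"
  assumes W: "matrix_weight W"
  shows "integrable (lebesgue_on {0..1}) (\<lambda>x. 1 / norm (matrix_inv (W x)))"
proof (rule Bochner_Integration.integrable_bound)
  note W = matrix_weightD[OF W]
  show "integrable (lebesgue_on {0..1}) (\<lambda>x. norm (W x))" using W by auto
  show "(\<lambda>x. 1 / norm (matrix_inv (W x))) \<in> borel_measurable (lebesgue_on {0..1})"
    using W(3) by (intro borel_measurable_divide borel_measurable_const borel_measurable_norm) auto
  show "AE x in lebesgue_on {0..1}. norm (1 / norm (matrix_inv (W x))) \<le> norm (norm (W x))"
    using W(1) by (rule eventually_mono) (auto simp: norm_matrix_inv)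
qed

lemma integral_dyadic_ivl_pos:
  assumes h: "integrable (lebesgue_on {0..1}) h" and k: "k < 2 ^ n" and pos: "AE x in lebesgue_on {0..1}. 0 < (h x :: real)"
  shows "0 < integral\<^sup>L (lebesgue_on (dyadic_ivl n k)) h"
proof -
  have ap: "AE x in lebesgue_on (dyadic_ivl n k). 0 < h x" by (rule AE_dyadic_ivl[OF pos k])
  have an: "AE x in lebesgue_on (dyadic_ivl n k). 0 \<le> h x" using ap by (rule eventually_mono) simp
  have "integral\<^sup>L (lebesgue_on (dyadic_ivl n k)) h \<noteq> 0"
  proof
    assume "integral\<^sup>L (lebesgue_on (dyadic_ivl n k)) h = 0"
    then have "AE x in lebesgue_on (dyadic_ivl n k). h x = 0"
      using integral_nonneg_eq_0_iff_AE[OF integrable_dyadic_ivl[OF h k] an] by simp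
    with ap have "AE x in lebesgue_on (dyadic_ivl n k). False" by eventually_elim simp
    then have "AE x in lebesgue. x \<notin> dyadic_ivl n k" by (simp add: AE_restrict_space_iff sets_lebesgue_dyadic_ivl)
    then have "emeasure lebesgue (dyadic_ivl n k) = 0"
      by (subst (asm) AE_iff_measurable[of "dyadic_ivl n k"]) (simp_all add: sets_lebesgue_dyadic_ivl)
    then have "measure lebesgue (dyadic_ivl n k) = 0"
      by (simp add: measure_def)
    then show False by (simp add: measure_dyadic_ivl)
  qed
  moreover have "0 \<le> integral\<^sup>L (lebesgue_on (dyadic_ivl n k)) h" using an by (rule integral_nonneg_AE)
  ultimately show ?thesis by simp
qed

lemma matrix_inv_scale_cancel:
  fixes M :: "complex^'n^'n"
  assumes "invertible M" "c \<noteq> 0"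
  shows "matrix_inv (c *\<^sub>R M) *v (c *\<^sub>R X) = matrix_inv M *v X"
proof -
  have "invertible (c *\<^sub>R M)"
    unfolding invertible_left_inverse
    using matrix_inv_mult[OF assms(1)] assms(2)
    by (intro exI[of _ "(1/c) *\<^sub>R matrix_inv M"] mat_eqI)
      (simp add: mv_scaleR mv_scaleR_right matrix_inv_cancel[OF assms(1)] flip: matrix_vector_mul_assoc)
  then have "matrix_inv (c *\<^sub>R M) *v ((c *\<^sub>R M) *v (matrix_inv M *v X)) = matrix_inv M *v X"
    by (rule matrix_inv_cancel)
  then show ?thesis by (simp add: mv_scaleR matrix_inv_cancel[OF assms(1)] del: matrix_vector_mul_assoc)
qed

lemma weight_integral_coercive:
  fixes W :: "real \<Rightarrow> complex^'n^'n"
  assumes W: "matrix_weight W" and k: "k < 2 ^ n"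
  defines "L \<equiv> integral\<^sup>L (lebesgue_on (dyadic_ivl n k)) (\<lambda>x. 1 / norm (matrix_inv (W x)))"
  shows "0 < L" "L * (norm v)\<^sup>2 \<le> v \<bullet> (integral\<^sup>L (lebesgue_on (dyadic_ivl n k)) W *v v)"
    "invertible (integral\<^sup>L (lebesgue_on (dyadic_ivl n k)) W)"
proof -
  note WD = matrix_weightD[OF W]
  have iL: "integrable (lebesgue_on {0..1}) (\<lambda>x. 1 / norm (matrix_inv (W x)))" by (rule integrable_lower[OF W])
  show pos: "0 < L" unfolding L_def
    by (rule integral_dyadic_ivl_pos[OF iL k], rule eventually_mono[OF WD(1)]) (metis norm_matrix_inv(1) zero_less_divide_1_iff)
  show LM: "L * (norm v)\<^sup>2 \<le> v \<bullet> (integral\<^sup>L (lebesgue_on (dyadic_ivl n k)) W *v v)" for v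
  proof -
    have "L * (norm v)\<^sup>2 = integral\<^sup>L (lebesgue_on (dyadic_ivl n k)) (\<lambda>x. 1 / norm (matrix_inv (W x)) * (norm v)\<^sup>2)"
      unfolding L_def by (rule integral_mult_left_zero[symmetric])
    also have "\<dots> \<le> integral\<^sup>L (lebesgue_on (dyadic_ivl n k)) (\<lambda>x. v \<bullet> (W x *v v))"
    proof (rule integral_mono_AE)
      show "integrable (lebesgue_on (dyadic_ivl n k)) (\<lambda>x. 1 / norm (matrix_inv (W x)) * (norm v)\<^sup>2)"
        by (intro integrable_mult_left integrable_dyadic_ivl[OF iL k])
      show "integrable (lebesgue_on (dyadic_ivl n k)) (\<lambda>x. v \<bullet> (W x *v v))"
        by (rule integral_inner_mv[OF integrable_dyadic_ivl[OF WD(2) k]])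
      show "AE x in lebesgue_on (dyadic_ivl n k). 1 / norm (matrix_inv (W x)) * (norm v)\<^sup>2 \<le> v \<bullet> (W x *v v)"
        using AE_dyadic_ivl[OF WD(1) k]
      proof (rule eventually_mono)
        fix x assume "psd (W x) \<and> invertible (W x)"
        then show "1 / norm (matrix_inv (W x)) * (norm v)\<^sup>2 \<le> v \<bullet> (W x *v v)"
          using psd_lower_bound[of "W x" v] norm_matrix_inv(1)[of "W x"] by (simp add: field_simps)
      qed
    qed
    also have "\<dots> = v \<bullet> (integral\<^sup>L (lebesgue_on (dyadic_ivl n k)) W *v v)"
      by (rule integral_inner_mv(1)[OF integrable_dyadic_ivl[OF WD(2) k], symmetric])
    finally show ?thesis .
  qed
  show "invertible (integral\<^sup>L (lebesgue_on (dyadic_ivl n k)) W)" using LM pos by (rule coercive_invertible)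
qed

text \<open>The matrix weighted maximal function of \<open>f\<close>, measured against the scalar minorant of \<open>W\<close>, is bounded by
  \<open>2\<close> times the unweighted norm of \<open>f\<close>, uniformly in the depth \<open>j\<close>.\<close>

theorem weighted_maximal:
  fixes W :: "real \<Rightarrow> complex^'n^'n"
  assumes W: "matrix_weight W" and f: "f \<in> L2"
  shows "tree_max_sum (\<lambda>n k. integral\<^sup>L (lebesgue_on (dyadic_ivl n k)) (\<lambda>x. 1 / norm (matrix_inv (W x))))
    (\<lambda>n k. norm (matrix_inv (avg (dyadic_ivl n k) W) *v avg (dyadic_ivl n k) (\<lambda>x. msqrt (W x) *v f x))) j 0 0 0
    \<le> 4 * (L2_norm f)\<^sup>2"
proof -
  note WD = matrix_weightD[OF W]
  let ?M = "\<lambda>n k. integral\<^sup>L (lebesgue_on (dyadic_ivl n k)) W"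
  let ?X = "\<lambda>n k. integral\<^sup>L (lebesgue_on (dyadic_ivl n k)) (\<lambda>x. msqrt (W x) *v f x)"
  let ?F = "\<lambda>n k. integral\<^sup>L (lebesgue_on (dyadic_ivl n k)) (\<lambda>x. (norm (f x))\<^sup>2)"
  let ?L = "\<lambda>n k. integral\<^sup>L (lebesgue_on (dyadic_ivl n k)) (\<lambda>x. 1 / norm (matrix_inv (W x)))"
  have iX: "integrable (lebesgue_on {0..1}) (\<lambda>x. msqrt (W x) *v f x)" by (rule integrable_sqrt_weight[OF W f])
  have iF: "integrable (lebesgue_on {0..1}) (\<lambda>x. (norm (f x))\<^sup>2)" using f by (simp add: L2_def)
  have iL: "integrable (lebesgue_on {0..1}) (\<lambda>x. 1 / norm (matrix_inv (W x)))" by (rule integrable_lower[OF W])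
  have XF: "2 * (y \<bullet> ?X n k) \<le> y \<bullet> (?M n k *v y) + ?F n k" if k: "k < 2 ^ n" for n k y
  proof -
    have i1: "integrable (lebesgue_on (dyadic_ivl n k)) (\<lambda>x. 2 * (y \<bullet> (msqrt (W x) *v f x)))"
      using integrable_dyadic_ivl[OF iX k] by simp
    have i2: "integrable (lebesgue_on (dyadic_ivl n k)) (\<lambda>x. y \<bullet> (W x *v y))"
      by (rule integral_inner_mv[OF integrable_dyadic_ivl[OF WD(2) k]])
    have i3: "integrable (lebesgue_on (dyadic_ivl n k)) (\<lambda>x. (norm (f x))\<^sup>2)"
      by (rule integrable_dyadic_ivl[OF iF k])
    have "2 * (y \<bullet> ?X n k) = integral\<^sup>L (lebesgue_on (dyadic_ivl n k)) (\<lambda>x. 2 * (y \<bullet> (msqrt (W x) *v f x)))"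
      using integrable_dyadic_ivl[OF iX k] by simp
    also have "\<dots> \<le> integral\<^sup>L (lebesgue_on (dyadic_ivl n k)) (\<lambda>x. y \<bullet> (W x *v y) + (norm (f x))\<^sup>2)"
    proof (rule integral_mono_AE[OF i1 Bochner_Integration.integrable_add[OF i2 i3]], rule eventually_mono[OF AE_dyadic_ivl[OF WD(1) k]])
      fix x assume "psd (W x) \<and> invertible (W x)"
      then have x: "psd (W x)" by simp
      let ?u = "msqrt (W x) *v y"
      have "y \<bullet> (msqrt (W x) *v f x) = ?u \<bullet> f x" by (rule psd_inner[OF psd_msqrt[OF x]])
      moreover have "0 \<le> (norm (?u - f x))\<^sup>2" by simp
      ultimately show "2 * (y \<bullet> (msqrt (W x) *v f x)) \<le> y \<bullet> (W x *v y) + (norm (f x))\<^sup>2"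
        unfolding norm_msqrt[OF x, symmetric]
        by (simp add: power2_norm_eq_inner inner_diff_left inner_diff_right inner_commute)
    qed
    also have "\<dots> = integral\<^sup>L (lebesgue_on (dyadic_ivl n k)) (\<lambda>x. y \<bullet> (W x *v y)) + ?F n k"
      by (rule Bochner_Integration.integral_add[OF i2 i3])
    also have "integral\<^sup>L (lebesgue_on (dyadic_ivl n k)) (\<lambda>x. y \<bullet> (W x *v y)) = y \<bullet> (?M n k *v y)"
      by (rule integral_inner_mv(1)[OF integrable_dyadic_ivl[OF WD(2) k], symmetric])
    finally show ?thesis by simp
  qed
  have "tree_max_sum ?L (\<lambda>n k. norm (matrix_inv (avg (dyadic_ivl n k) W) *v avg (dyadic_ivl n k) (\<lambda>x. msqrt (W x) *v f x))) j 0 0 0 \<le> 4 * ?F 0 0"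
  proof (rule matrix_maximal_tree[where X = ?X and M = ?M and F = ?F and L = ?L])
    fix n k :: nat assume k: "k < 2 ^ n"
    show "?X n k = ?X (Suc n) (2 * k) + ?X (Suc n) (2 * k + 1)" by (rule integral_dyadic_ivl_split[OF iX k])
    show "?M n k = ?M (Suc n) (2 * k) + ?M (Suc n) (2 * k + 1)" by (rule integral_dyadic_ivl_split[OF WD(2) k])
    show "?F n k = ?F (Suc n) (2 * k) + ?F (Suc n) (2 * k + 1)" by (rule integral_dyadic_ivl_split[OF iF k])
    show "?L n k = ?L (Suc n) (2 * k) + ?L (Suc n) (2 * k + 1)" by (rule integral_dyadic_ivl_split[OF iL k])
    show "psd (?M n k)"
      by (rule psd_integral[OF integrable_dyadic_ivl[OF WD(2) k]], rule eventually_mono[OF AE_dyadic_ivl[OF WD(1) k]]) simp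
    show "0 < ?L n k" by (rule weight_integral_coercive[OF W k])
    show "?L n k * (norm v)\<^sup>2 \<le> v \<bullet> (?M n k *v v)" for v by (rule weight_integral_coercive[OF W k])
    have "invertible (?M n k)" by (rule weight_integral_coercive[OF W k])
    then show "norm (matrix_inv (avg (dyadic_ivl n k) W) *v avg (dyadic_ivl n k) (\<lambda>x. msqrt (W x) *v f x)) = norm (matrix_inv (?M n k) *v ?X n k)"
      unfolding avg_dyadic_ivl by (subst matrix_inv_scale_cancel) auto
  qed (use XF in auto)
  also have "?F 0 0 = (L2_norm f)\<^sup>2"
    by (simp add: dyadic_ivl_0 L2_norm_def)
  finally show ?thesis .
qed

section \<open>The bilinear embedding\<close>

lemma tree_sum_mono:
  assumes "\<And>n k. k < 2 ^ n \<Longrightarrow> a n k \<le> b n k" "k < 2 ^ n"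
  shows "tree_sum a j n k \<le> tree_sum b j n k"
  using assms(2)
proof (induction j arbitrary: n k)
  case (Suc j)
  have "2 * k < 2 ^ Suc n" "2 * k + 1 < 2 ^ Suc n" using Suc.prems by auto
  then show ?case using Suc.IH assms(1)[OF Suc.prems] by (simp add: add_mono)
qed (simp add: assms(1))

lemma tree_max_sum_scale: "tree_max_sum (\<lambda>n k. s * L n k) p j c n k = s * tree_max_sum L p j c n k"
  by (induction j arbitrary: c n k) (simp_all add: algebra_simps)

lemma bounded_linear_mv: "bounded_linear ((*v) (A::complex^'n^'m))"
  by (rule bounded_bilinear.bounded_linear_right[OF bounded_bilinear_mv])

lemma norm_le_onorm:
  fixes A :: "complex^'n^'n"
  shows "norm A \<le> real CARD('n)^2 * onorm ((*v) A)"
  by (rule norm_le_op_bound) (simp add: op_bound_def onorm[OF bounded_linear_mv])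

lemma cond_number_bound:
  fixes W :: "real \<Rightarrow> complex^'n^'n"
  assumes "cond_number W < \<infinity>"
  shows "AE x in lebesgue_on {0..1}. onorm ((*v) (W x)) * onorm ((*v) (matrix_inv (W x))) \<le> enn2real (cond_number W)"
proof -
  have "AE x in lebesgue_on {0..1}. ennreal (onorm ((*v) (W x)) * onorm ((*v) (matrix_inv (W x)))) \<le> cond_number W"
    unfolding cond_number_def by (rule esssup_AE)
  then show ?thesis
  proof (rule eventually_mono)
    fix x assume x: "ennreal (onorm ((*v) (W x)) * onorm ((*v) (matrix_inv (W x)))) \<le> cond_number W"
    have "0 \<le> onorm ((*v) (W x)) * onorm ((*v) (matrix_inv (W x)))"
      by (intro mult_nonneg_nonneg onorm_pos_le bounded_linear_mv)
    then show "onorm ((*v) (W x)) * onorm ((*v) (matrix_inv (W x))) \<le> enn2real (cond_number W)"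
      using enn2real_mono[OF x] assms by simp
  qed
qed

text \<open>The hypothesis says that \<open>E\<close> compensates for the gap between \<open>l\<close> and \<open>1 / m\<close>. The free parameter
  \<open>t\<close> makes the later estimate homogeneous in \<open>f\<close> and \<open>g\<close>.\<close>

lemma weighted_am_gm:
  fixes E l m c d t :: real
  assumes "0 \<le> E" "0 \<le> l" "0 \<le> m" "1 \<le> E\<^sup>2 * (l * m)" "0 \<le> c" "0 \<le> d" "0 < t"
  shows "c * d \<le> E / 2 * (t * l * c\<^sup>2 + m / t * d\<^sup>2)"
proof (rule power2_le_imp_le)
  have "(c * d)\<^sup>2 \<le> E\<^sup>2 * (l * m) * (c * d)\<^sup>2"
    using mult_right_mono[OF assms(4), of "(c * d)\<^sup>2"] by simp
  also have "\<dots> = (E / 2)\<^sup>2 * (4 * (t * l * c\<^sup>2) * (m / t * d\<^sup>2))"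
    using assms(7) by (simp add: power2_eq_square field_simps)
  also have "\<dots> \<le> (E / 2)\<^sup>2 * (t * l * c\<^sup>2 + m / t * d\<^sup>2)\<^sup>2"
  proof (intro mult_left_mono)
    have "4 * u * v \<le> (u + v)\<^sup>2" for u v :: real
      using zero_le_power2[of "u - v"] by (simp add: power2_diff power2_sum)
    then show "4 * (t * l * c\<^sup>2) * (m / t * d\<^sup>2) \<le> (t * l * c\<^sup>2 + m / t * d\<^sup>2)\<^sup>2" .
  qed simp
  finally show "(c * d)\<^sup>2 \<le> (E / 2 * (t * l * c\<^sup>2 + m / t * d\<^sup>2))\<^sup>2"
    by (simp only: power_mult_distrib)
  show "0 \<le> E / 2 * (t * l * c\<^sup>2 + m / t * d\<^sup>2)"
    using assms by simp
qed

lemma norm_msqrt_trace: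
  assumes "psd A" shows "norm (msqrt A *v x) \<le> sqrt (Re (trace A)) * norm x"
proof (rule power2_le_imp_le)
  show "(norm (msqrt A *v x))\<^sup>2 \<le> (sqrt (Re (trace A)) * norm x)\<^sup>2"
    using psd_trace_bound[OF assms, of x] psd_trace_nonneg[OF assms]
    by (simp add: norm_msqrt[OF assms] power_mult_distrib)
qed (simp add: psd_trace_nonneg[OF assms])

text \<open>The condition number enters only through \<open>1 \<le> E\<^sup>2 l m\<close> for \<open>l\<close> and \<open>m\<close> the reciprocals of the norms
  of \<open>W\<^sup>-\<^sup>1\<close> and \<open>W\<close>, where \<open>E\<close> is a multiple of its square root. The maximal estimate is applied
  to \<open>W\<close> and \<open>f\<close>, and to \<open>W\<^sup>-\<^sup>1\<close> and \<open>g\<close>.\<close>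

theorem bilinear_embedding:
  fixes A :: "real set \<Rightarrow> complex^'n^'n" and W :: "real \<Rightarrow> complex^'n^'n"
  assumes W: "matrix_weight W" and car: "carleson C A" and C: "0 \<le> C"
    and cond: "cond_number W < \<infinity>" and f: "f \<in> L2" and g: "g \<in> L2"
  shows "bilinear_sum A W f g \<le>
    ennreal (4 * real CARD('n) ^ 3 * C * enn2real (cond_number W) powr (1/2) * L2_norm f * L2_norm g)"
proof -
  define V where "V = (\<lambda>x. matrix_inv (W x))"
  have V: "matrix_weight V" unfolding V_def by (rule matrix_weight_inv[OF W])
  note WD = matrix_weightD[OF W]
  define \<kappa> where "\<kappa> = enn2real (cond_number W)"
  define E where "E = real CARD('n)^2 * sqrt \<kappa>"
  have E: "0 \<le> E" by (simp add: E_def \<kappa>_def)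
  define p where "p = (\<lambda>n k. norm (matrix_inv (avg (dyadic_ivl n k) W) *v avg (dyadic_ivl n k) (\<lambda>x. msqrt (W x) *v f x)))"
  define q where "q = (\<lambda>n k. norm (matrix_inv (avg (dyadic_ivl n k) V) *v avg (dyadic_ivl n k) (\<lambda>x. msqrt (V x) *v g x)))"
  define a where "a = (\<lambda>n k. Re (trace (A (dyadic_ivl n k))))"
  define L where "L = (\<lambda>n k. integral\<^sup>L (lebesgue_on (dyadic_ivl n k)) (\<lambda>x. 1 / norm (matrix_inv (W x))))"
  define U where "U = (\<lambda>n k. integral\<^sup>L (lebesgue_on (dyadic_ivl n k)) (\<lambda>x. 1 / norm (matrix_inv (V x))))"
  let ?I = "\<lambda>n (k::nat). 1 / 2 ^ n :: real"
  let ?C = "real CARD('n) * C"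
  have psdA: "psd (A Q)" if "Q \<in> dyadic" for Q using car that by (simp add: carleson_def)
  have leaf: "c * d * ?I n k \<le> E / 2 * (t * L n k * c\<^sup>2 + 1 / t * U n k * d\<^sup>2)"
    if k: "k < 2 ^ n" and cd: "0 \<le> c" "0 \<le> d" and t: "0 < t" for n k c d t
  proof -
    have iL: "integrable (lebesgue_on (dyadic_ivl n k)) (\<lambda>x. 1 / norm (matrix_inv (W x)))"
      by (rule integrable_dyadic_ivl[OF integrable_lower[OF W] k])
    have iU: "integrable (lebesgue_on (dyadic_ivl n k)) (\<lambda>x. 1 / norm (matrix_inv (V x)))"
      by (rule integrable_dyadic_ivl[OF integrable_lower[OF V] k])
    have "c * d * ?I n k = integral\<^sup>L (lebesgue_on (dyadic_ivl n k)) (\<lambda>x. c * d)"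
      unfolding integral_dyadic_ivl_const by simp
    also have "\<dots> \<le> integral\<^sup>L (lebesgue_on (dyadic_ivl n k))
        (\<lambda>x. E / 2 * ((t * c\<^sup>2) * (1 / norm (matrix_inv (W x))) + (1 / t * d\<^sup>2) * (1 / norm (matrix_inv (V x)))))"
    proof (rule integral_mono_AE)
      show "integrable (lebesgue_on (dyadic_ivl n k)) (\<lambda>x. c * d)"
        using integrable_dyadic_ivl[of "\<lambda>x. c * d", OF _ k] by (simp add: lebesgue_on_UNIV_eq dyadic_ivl_def)
      show "integrable (lebesgue_on (dyadic_ivl n k))
        (\<lambda>x. E / 2 * ((t * c\<^sup>2) * (1 / norm (matrix_inv (W x))) + (1 / t * d\<^sup>2) * (1 / norm (matrix_inv (V x)))))"
        by (intro integrable_mult_right Bochner_Integration.integrable_add iL iU)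
      show "AE x in lebesgue_on (dyadic_ivl n k). c * d \<le>
        E / 2 * ((t * c\<^sup>2) * (1 / norm (matrix_inv (W x))) + (1 / t * d\<^sup>2) * (1 / norm (matrix_inv (V x))))"
        using AE_dyadic_ivl[OF WD(1) k] AE_dyadic_ivl[OF cond_number_bound[OF cond] k]
      proof eventually_elim
        fix x assume x: "psd (W x) \<and> invertible (W x)"
          and o: "onorm ((*v) (W x)) * onorm ((*v) (matrix_inv (W x))) \<le> enn2real (cond_number W)"
        have pos: "0 < norm (matrix_inv (W x))" "0 < norm (W x)"
          using x norm_matrix_inv(1)[of "W x"] norm_matrix_inv(1)[of "matrix_inv (W x)"] psd_matrix_inv[of "W x"] by auto
        have VV: "matrix_inv (V x) = W x" using x by (simp add: V_def psd_matrix_inv)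
        have "norm (W x) * norm (matrix_inv (W x)) \<le>
          (real CARD('n)^2 * onorm ((*v) (W x))) * (real CARD('n)^2 * onorm ((*v) (matrix_inv (W x))))"
          by (intro mult_mono norm_le_onorm mult_nonneg_nonneg onorm_pos_le bounded_linear_mv) auto
        also have "\<dots> = (real CARD('n)^2)^2 * (onorm ((*v) (W x)) * onorm ((*v) (matrix_inv (W x))))"
          by (simp add: power2_eq_square)
        also have "\<dots> \<le> (real CARD('n)^2)^2 * \<kappa>"
          using o unfolding \<kappa>_def by (intro mult_left_mono) auto
        also have "\<dots> = E\<^sup>2" by (simp add: E_def power_mult_distrib \<kappa>_def)
        finally have "1 \<le> E\<^sup>2 * ((1 / norm (matrix_inv (W x))) * (1 / norm (W x)))"
          using pos by (simp add: field_simps)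
        from weighted_am_gm[OF E _ _ this cd t]
        show "c * d \<le> E / 2 * ((t * c\<^sup>2) * (1 / norm (matrix_inv (W x))) + (1 / t * d\<^sup>2) * (1 / norm (matrix_inv (V x))))"
          by (simp add: VV mult_ac)
      qed
    qed
    also have "\<dots> = E / 2 * (t * L n k * c\<^sup>2 + 1 / t * U n k * d\<^sup>2)"
    proof -
      have "integral\<^sup>L (lebesgue_on (dyadic_ivl n k))
        (\<lambda>x. (t * c\<^sup>2) * (1 / norm (matrix_inv (W x))) + (1 / t * d\<^sup>2) * (1 / norm (matrix_inv (V x))))
        = integral\<^sup>L (lebesgue_on (dyadic_ivl n k)) (\<lambda>x. (t * c\<^sup>2) * (1 / norm (matrix_inv (W x))))
        + integral\<^sup>L (lebesgue_on (dyadic_ivl n k)) (\<lambda>x. (1 / t * d\<^sup>2) * (1 / norm (matrix_inv (V x))))"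
        by (intro Bochner_Integration.integral_add integrable_mult_right iL iU)
      also have "\<dots> = t * c\<^sup>2 * L n k + 1 / t * d\<^sup>2 * U n k"
        unfolding L_def U_def by (simp only: integral_mult_right_zero)
      finally show ?thesis by (simp only: integral_mult_right_zero mult_ac)
    qed
    finally show ?thesis .
  qed
  define \<phi> where "\<phi> = (\<lambda>Q. norm (msqrt (A Q) *v (matrix_inv (avg Q W) *v avg Q (\<lambda>x. msqrt (W x) *v f x))) *
      norm (msqrt (A Q) *v (matrix_inv (avg Q V) *v avg Q (\<lambda>x. msqrt (V x) *v g x))))"
  have \<phi>: "\<phi> (dyadic_ivl n k) \<le> a n k * p n k * q n k" if k: "k < 2 ^ n" for n k
  proof -
    note A = psdA[OF dyadic_ivl_in_dyadic[OF k]]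
    have "\<phi> (dyadic_ivl n k) \<le> (sqrt (a n k) * p n k) * (sqrt (a n k) * q n k)"
      unfolding \<phi>_def a_def p_def q_def
      using psd_trace_nonneg[OF A] by (intro mult_mono norm_msqrt_trace[OF A]) auto
    also have "\<dots> = a n k * p n k * q n k"
      using psd_trace_nonneg[OF A] by (simp add: a_def mult_ac)
    finally show ?thesis .
  qed
  have bound: "tree_sum (\<lambda>n k. \<phi> (dyadic_ivl n k)) N 0 0 \<le> 2 * sqrt (2 * ?C * E * (L2_norm f)\<^sup>2) * sqrt (2 * ?C * E * (L2_norm g)\<^sup>2)" for N
  proof (rule le_two_sqrt)
    fix t :: real assume t: "0 < t"
    have "tree_sum (\<lambda>n k. \<phi> (dyadic_ivl n k)) N 0 0 \<le> tree_sum (\<lambda>n k. a n k * p n k * q n k) N 0 0"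
      by (intro tree_sum_mono \<phi>) auto
    also have "\<dots> \<le> ?C * (E / 2) * (tree_max_sum (\<lambda>n k. t * L n k) p N 0 0 0 + tree_max_sum (\<lambda>n k. 1 / t * U n k) q N 0 0 0)"
    proof (rule carleson_tree_bound[where I = ?I])
      fix n k j :: nat assume k: "k < 2 ^ n"
      show "0 \<le> a n k" unfolding a_def by (rule psd_trace_nonneg[OF psdA[OF dyadic_ivl_in_dyadic[OF k]]])
      show "tree_sum a j n k \<le> ?C * ?I n k" unfolding a_def by (rule carleson_trace[OF car k])
      show "?I n k = ?I (Suc n) (2 * k) + ?I (Suc n) (2 * k + 1)" by simp
    qed (use leaf[OF _ _ _ t] C in \<open>auto simp: p_def q_def\<close>)
    also have "\<dots> = ?C * (E / 2) * (t * tree_max_sum L p N 0 0 0 + 1 / t * tree_max_sum U q N 0 0 0)"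
      unfolding tree_max_sum_scale ..
    also have "\<dots> \<le> ?C * (E / 2) * (t * (4 * (L2_norm f)\<^sup>2) + 1 / t * (4 * (L2_norm g)\<^sup>2))"
      using weighted_maximal[OF W f, of N] weighted_maximal[OF V g, of N] t C E
      unfolding L_def U_def p_def q_def by (intro mult_left_mono add_mono) auto
    also have "\<dots> = t * (2 * ?C * E * (L2_norm f)\<^sup>2) + 2 * ?C * E * (L2_norm g)\<^sup>2 / t"
      using t by (simp add: field_simps)
    finally show "tree_sum (\<lambda>n k. \<phi> (dyadic_ivl n k)) N 0 0 \<le> t * (2 * ?C * E * (L2_norm f)\<^sup>2) + 2 * ?C * E * (L2_norm g)\<^sup>2 / t" .
  qed (use C E in auto)
  have nn: "0 \<le> L2_norm f" "0 \<le> L2_norm g" by (simp_all add: L2_norm_def)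
  have "2 * sqrt (2 * ?C * E * (L2_norm f)\<^sup>2) * sqrt (2 * ?C * E * (L2_norm g)\<^sup>2) = 2 * (sqrt (2 * ?C * E))\<^sup>2 * L2_norm f * L2_norm g"
    using nn by (simp add: real_sqrt_mult power2_eq_square)
  also have "\<dots> = 4 * ?C * E * L2_norm f * L2_norm g" using C E by simp
  also have "\<dots> = 4 * real CARD('n) ^ 3 * C * \<kappa> powr (1/2) * L2_norm f * L2_norm g"
    by (simp add: E_def powr_half_sqrt \<kappa>_def power2_eq_square power3_eq_cube)
  finally have eq: "2 * sqrt (2 * ?C * E * (L2_norm f)\<^sup>2) * sqrt (2 * ?C * E * (L2_norm g)\<^sup>2) =
    4 * real CARD('n) ^ 3 * C * \<kappa> powr (1/2) * L2_norm f * L2_norm g" .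
  have "bilinear_sum A W f g = (\<Sum>\<^sub>\<infinity>Q\<in>dyadic. ennreal (\<phi> Q))"
    by (simp add: bilinear_sum_def dyadic_in_unit \<phi>_def V_def)
  also have "\<dots> \<le> ennreal (2 * sqrt (2 * ?C * E * (L2_norm f)\<^sup>2) * sqrt (2 * ?C * E * (L2_norm g)\<^sup>2))"
    by (rule infsum_dyadic_le[OF _ bound]) (simp add: \<phi>_def)
  finally show ?thesis unfolding eq \<kappa>_def .
qed

section \<open>Testing on a single interval\<close>

lemma psd_scaled_identity: "0 \<le> c \<Longrightarrow> psd (c *\<^sub>R mat 1 :: complex^'n^'n)"
  unfolding psd_iff_inner by (simp add: hermitian_scaleR hermitian_mat1 mv_scaleR)

lemma measure_dyadic_mono:
  assumes "K \<in> dyadic" "K' \<in> dyadic" "K \<subseteq> K'"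
  shows "measure lebesgue K \<le> measure lebesgue K'" "0 < measure lebesgue K"
proof -
  obtain n k m r where "K = dyadic_ivl n k" and K': "K' = dyadic_ivl m r" using assms unfolding dyadic_iff by blast
  then show "0 < measure lebesgue K" by (simp add: measure_dyadic_ivl)
  show "measure lebesgue K \<le> measure lebesgue K'"
    using \<open>K = dyadic_ivl n k\<close> K' by (intro measure_mono_fmeasurable assms) (auto simp: dyadic_ivl_def)
qed

text \<open>The extremal Carleson sequence for one interval: all of the allowed mass sits at \<open>K\<close>, as a
  multiple of the identity.\<close>

lemma carleson_single:
  assumes K: "K \<in> dyadic"
  shows "carleson 1 (\<lambda>Q. if Q = K then measure lebesgue K *\<^sub>R mat 1 else 0 :: complex^'n^'n)"
    (is "carleson 1 ?A")
  unfolding carleson_def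
proof (intro conjI ballI)
  have 0: "psd (0 :: complex^'n^'n)" using psd_scaled_identity[of 0, where 'n='n] by simp
  fix K' assume K': "K' \<in> dyadic"
  show "psd (?A K')" by (cases "K' = K") (simp_all add: 0 psd_scaled_identity)
  show "(1 / measure lebesgue K') *\<^sub>R (\<Sum>\<^sub>\<infinity>Q\<in>dyadic_in K'. ?A Q) \<preceq> 1 *\<^sub>R mat 1" "?A summable_on dyadic_in K'"
  proof -
    let ?s = "if K \<subseteq> K' then measure lebesgue K else 0"
    have hs: "(?A has_sum (?s *\<^sub>R mat 1)) (dyadic_in K')"
      by (rule has_sum_finite_neutralI[where B = "{K} \<inter> dyadic_in K'"])
        (use K in \<open>auto simp: dyadic_in_def\<close>)
    then show "?A summable_on dyadic_in K'" by (auto simp: summable_on_def)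
    have m: "0 < measure lebesgue K'" by (rule measure_dyadic_mono[OF K' K' order_refl])
    have "?s \<le> measure lebesgue K'" using measure_dyadic_mono[OF K K'] m by auto
    then have "0 \<le> 1 - ?s / measure lebesgue K'" using m by (simp add: field_simps)
    then have "psd ((1 - ?s / measure lebesgue K') *\<^sub>R mat 1 :: complex^'n^'n)" by (rule psd_scaled_identity)
    then show "(1 / measure lebesgue K') *\<^sub>R (\<Sum>\<^sub>\<infinity>Q\<in>dyadic_in K'. ?A Q) \<preceq> 1 *\<^sub>R mat 1"
      unfolding loewner_le_def infsumI[OF hs] by (simp add: scaleR_diff_left)
  qed
qed

lemma bilinear_sum_single_ge:
  fixes W :: "real \<Rightarrow> complex^'n^'n"
  assumes K: "K \<in> dyadic"
  defines "A \<equiv> (\<lambda>Q. if Q = K then measure lebesgue K *\<^sub>R mat 1 else 0 :: complex^'n^'n)"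
  shows "ennreal (measure lebesgue K *
      (norm (matrix_inv (avg K W) *v avg K (\<lambda>x. msqrt (W x) *v f x)) *
       norm (matrix_inv (avg K (\<lambda>x. matrix_inv (W x))) *v avg K (\<lambda>x. msqrt (matrix_inv (W x)) *v g x))))
    \<le> bilinear_sum A W f g" (is "ennreal (_ * (norm ?u * norm ?v)) \<le> _")
proof -
  let ?\<phi> = "\<lambda>Q. ennreal (norm (msqrt (A Q) *v (matrix_inv (avg Q W) *v avg Q (\<lambda>x. msqrt (W x) *v f x))) *
      norm (msqrt (A Q) *v (matrix_inv (avg Q (\<lambda>x. matrix_inv (W x))) *v avg Q (\<lambda>x. msqrt (matrix_inv (W x)) *v g x))))"
  have psdA: "psd (A K)" by (simp add: A_def psd_scaled_identity)
  have n: "norm (msqrt (A K) *v w) = sqrt (measure lebesgue K) * norm w" for w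
  proof (rule power2_eq_imp_eq)
    show "(norm (msqrt (A K) *v w))\<^sup>2 = (sqrt (measure lebesgue K) * norm w)\<^sup>2"
      by (simp add: norm_msqrt[OF psdA] power_mult_distrib) (simp add: A_def mv_scaleR power2_norm_eq_inner)
  qed auto
  have "ennreal (measure lebesgue K * (norm ?u * norm ?v)) = ?\<phi> K"
    unfolding n by (intro arg_cong[where f = ennreal]) (simp add: mult_ac)
  also have "\<dots> = (\<Sum>Q\<in>{K}. ?\<phi> Q)" by simp
  also have "\<dots> \<le> (\<Sum>\<^sub>\<infinity>Q\<in>dyadic_in {0..1}. ?\<phi> Q)"
    by (subst nonneg_infsum_complete, simp) (rule SUP_upper, simp add: K dyadic_in_unit)
  finally show ?thesis by (simp add: bilinear_sum_def)
qed

lemma integral_indicator_dyadic_ivl: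
  fixes h :: "real \<Rightarrow> real"
  assumes "k < 2 ^ n"
  shows "integral\<^sup>L (lebesgue_on {0..1}) (\<lambda>x. indicator (dyadic_ivl n k) x * h x) = integral\<^sup>L (lebesgue_on (dyadic_ivl n k)) h"
proof -
  have "integral\<^sup>L (lebesgue_on {0..1}) (\<lambda>x. indicator (dyadic_ivl n k) x * h x) =
    integral\<^sup>L lebesgue (\<lambda>x. indicator {0..1} x *\<^sub>R (indicator (dyadic_ivl n k) x * h x))"
    by (rule integral_restrict_space) simp
  also have "(\<lambda>x. indicator {0..1} x *\<^sub>R (indicator (dyadic_ivl n k) x * h x)) = (\<lambda>x. indicator (dyadic_ivl n k) x *\<^sub>R h x)"
    using dyadic_ivl_subset_unit[OF assms] by (auto simp: fun_eq_iff indicator_def)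
  also have "integral\<^sup>L lebesgue \<dots> = integral\<^sup>L (lebesgue_on (dyadic_ivl n k)) h"
    by (rule integral_restrict_space[symmetric]) (simp add: sets_lebesgue_dyadic_ivl)
  finally show ?thesis .
qed

text \<open>With this \<open>f\<close> the average of \<open>W\<^sup>1\<^sup>/\<^sup>2 f\<close> is the average of \<open>W\<close> applied to \<open>u\<close>, so the weighted
  average reproduces the vector \<open>u\<close> exactly.\<close>

lemma test_function:
  fixes W :: "real \<Rightarrow> complex^'n^'n" and u :: "complex^'n"
  assumes W: "matrix_weight W" and k: "k < 2 ^ n"
  defines "f \<equiv> (\<lambda>x. indicator (dyadic_ivl n k) x *\<^sub>R (msqrt (W x) *v u))"
  defines "M \<equiv> integral\<^sup>L (lebesgue_on (dyadic_ivl n k)) W"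
  shows "f \<in> L2" "L2_norm f = sqrt (u \<bullet> (M *v u))"
    "matrix_inv (avg (dyadic_ivl n k) W) *v avg (dyadic_ivl n k) (\<lambda>x. msqrt (W x) *v f x) = u"
proof -
  note WD = matrix_weightD[OF W]
  have psd: "AE x in lebesgue_on {0..1}. psd (W x)" using WD(1) by (rule eventually_mono) simp
  have meas: "f \<in> borel_measurable (lebesgue_on {0..1})"
    unfolding f_def
  proof (intro borel_measurable_scaleR borel_measurable_mv borel_measurable_msqrt psd)
    show "(\<lambda>x. indicator (dyadic_ivl n k) x) \<in> borel_measurable (lebesgue_on {0..1})"
      by (intro borel_measurable_indicator) (simp add: sets_restrict_space_iff dyadic_ivl_subset_unit[OF k] sets_lebesgue_dyadic_ivl)
  qed (use WD in auto)
  have sq: "AE x in lebesgue_on {0..1}. indicator (dyadic_ivl n k) x * (u \<bullet> (W x *v u)) = (norm (f x))\<^sup>2"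
    using psd by (rule eventually_mono) (simp add: f_def power_mult_distrib norm_msqrt indicator_def)
  have int: "integrable (lebesgue_on {0..1}) (\<lambda>x. indicator (dyadic_ivl n k) x * (u \<bullet> (W x *v u)))"
    by (rule integrable_mult_indicator[where 'b=real, unfolded real_scaleR_def, OF _ integral_inner_mv(2)[OF WD(2)]])
      (simp add: sets_restrict_space_iff dyadic_ivl_subset_unit[OF k] sets_lebesgue_dyadic_ivl)
  have meas2: "(\<lambda>x. (norm (f x))\<^sup>2) \<in> borel_measurable (lebesgue_on {0..1})" using meas by measurable
  have "integrable (lebesgue_on {0..1}) (\<lambda>x. (norm (f x))\<^sup>2)"
    using integrable_cong_AE[OF _ meas2 sq] int by auto
  then show "f \<in> L2" using meas by (simp add: L2_def)
  have "integral\<^sup>L (lebesgue_on {0..1}) (\<lambda>x. (norm (f x))\<^sup>2) =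
    integral\<^sup>L (lebesgue_on {0..1}) (\<lambda>x. indicator (dyadic_ivl n k) x * (u \<bullet> (W x *v u)))"
    using integral_cong_AE[OF _ meas2 sq] int by auto
  also have "\<dots> = integral\<^sup>L (lebesgue_on (dyadic_ivl n k)) (\<lambda>x. u \<bullet> (W x *v u))" by (rule integral_indicator_dyadic_ivl[OF k])
  also have "\<dots> = u \<bullet> (M *v u)"
    unfolding M_def by (rule integral_inner_mv(1)[OF integrable_dyadic_ivl[OF WD(2) k], symmetric])
  finally show "L2_norm f = sqrt (u \<bullet> (M *v u))" by (simp add: L2_norm_def)
  have iW: "integrable (lebesgue_on (dyadic_ivl n k)) W" by (rule integrable_dyadic_ivl[OF WD(2) k])
  have bl: "bounded_linear (\<lambda>A::complex^'n^'n. A *v u)" by (rule bounded_bilinear.bounded_linear_left[OF bounded_bilinear_mv])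
  have "integral\<^sup>L (lebesgue_on (dyadic_ivl n k)) (\<lambda>x. msqrt (W x) *v f x) = integral\<^sup>L (lebesgue_on (dyadic_ivl n k)) (\<lambda>x. W x *v u)"
  proof (rule integral_cong_AE)
    have "integrable (lebesgue_on {0..1}) (\<lambda>x. msqrt (W x) *v f x)" by (rule integrable_sqrt_weight[OF W \<open>f \<in> L2\<close>])
    from integrable_dyadic_ivl[OF this k] show "(\<lambda>x. msqrt (W x) *v f x) \<in> borel_measurable (lebesgue_on (dyadic_ivl n k))" by auto
    show "(\<lambda>x. W x *v u) \<in> borel_measurable (lebesgue_on (dyadic_ivl n k))"
      using integrable_bounded_linear[OF bl iW] by auto
    have "AE x in lebesgue_on (dyadic_ivl n k). x \<in> dyadic_ivl n k"
      using AE_space[of "lebesgue_on (dyadic_ivl n k)"] by simp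
    with AE_dyadic_ivl[OF psd k] show "AE x in lebesgue_on (dyadic_ivl n k). msqrt (W x) *v f x = W x *v u"
      by eventually_elim (simp add: f_def matrix_vector_mul_assoc msqrt_square)
  qed
  also have "\<dots> = M *v u" unfolding M_def by (rule integral_bounded_linear[OF bl iW])
  finally have X: "integral\<^sup>L (lebesgue_on (dyadic_ivl n k)) (\<lambda>x. msqrt (W x) *v f x) = M *v u" .
  have inv: "invertible M" unfolding M_def by (rule weight_integral_coercive[OF W k])
  show "matrix_inv (avg (dyadic_ivl n k) W) *v avg (dyadic_ivl n k) (\<lambda>x. msqrt (W x) *v f x) = u"
    unfolding avg_dyadic_ivl X M_def[symmetric] by (subst matrix_inv_scale_cancel[OF inv]) (simp_all add: matrix_inv_cancel[OF inv] del: matrix_vector_mul_assoc)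
qed

text \<open>All the necessary information: the sequence concentrated at one interval, tested against the
  functions that reproduce \<open>u\<close> and \<open>v\<close>.\<close>

lemma single_interval_test:
  fixes W :: "real \<Rightarrow> complex^'n^'n"
  assumes W: "matrix_weight W" and k: "k < 2 ^ n" and c: "0 \<le> c"
    and hyp: "\<And>f g A. f \<in> L2 \<Longrightarrow> g \<in> L2 \<Longrightarrow> carleson 1 A \<Longrightarrow> bilinear_sum A W f g \<le> ennreal (c * L2_norm f * L2_norm g)"
  shows "norm u * norm v / 2 ^ n \<le> c * sqrt (u \<bullet> (integral\<^sup>L (lebesgue_on (dyadic_ivl n k)) W *v u)) *
      sqrt (v \<bullet> (integral\<^sup>L (lebesgue_on (dyadic_ivl n k)) (\<lambda>x. matrix_inv (W x)) *v v))"
proof -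
  note f = test_function[OF W k, of u] and g = test_function[OF matrix_weight_inv[OF W] k, of v]
  have K: "dyadic_ivl n k \<in> dyadic" by (rule dyadic_ivl_in_dyadic[OF k])
  have "ennreal (norm u * norm v / 2 ^ n) \<le> ennreal (c * sqrt (u \<bullet> (integral\<^sup>L (lebesgue_on (dyadic_ivl n k)) W *v u)) *
      sqrt (v \<bullet> (integral\<^sup>L (lebesgue_on (dyadic_ivl n k)) (\<lambda>x. matrix_inv (W x)) *v v)))"
    using order_trans[OF bilinear_sum_single_ge[OF K, of W] hyp[OF f(1) g(1) carleson_single[OF K]]]
    unfolding f(2,3) g(2,3) by (simp add: measure_dyadic_ivl)
  moreover have "0 \<le> sqrt (u \<bullet> (integral\<^sup>L (lebesgue_on (dyadic_ivl n k)) W *v u)) *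
      sqrt (v \<bullet> (integral\<^sup>L (lebesgue_on (dyadic_ivl n k)) (\<lambda>x. matrix_inv (W x)) *v v))"
    unfolding f(2)[symmetric] g(2)[symmetric] by (simp add: L2_norm_def)
  ultimately show ?thesis using c by (simp add: mult.assoc)
qed

section \<open>Finiteness of the condition number\<close>

text \<open>The primitive of \<open>\<psi>\<close> is monotone on the dyadic points of each generation, hence monotone by
  continuity. This makes differentiation along arbitrary intervals available.\<close>

lemma integral_interval_nonneg:
  fixes \<psi> :: "real \<Rightarrow> real"
  assumes int: "integrable (lebesgue_on {0..1}) \<psi>"
    and cells: "\<And>n k. k < 2 ^ n \<Longrightarrow> 0 \<le> integral\<^sup>L (lebesgue_on (dyadic_ivl n k)) \<psi>"
    and ab: "0 \<le> a" "a \<le> b" "b \<le> 1"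
  shows "0 \<le> integral\<^sup>L (lebesgue_on {a..b}) \<psi>"
proof -
  define F where "F = (\<lambda>t. integral\<^sup>L (lebesgue_on {0..t}) \<psi>)"
  have int0: "integrable (lebesgue_on {0..t}) \<psi>" if "t \<le> 1" for t
    by (rule integrable_subinterval[OF int]) (use that in auto)
  have Fdiff: "F t = F s + integral\<^sup>L (lebesgue_on {s..t}) \<psi>" if "0 \<le> s" "s \<le> t" "t \<le> 1" for s t
    unfolding F_def by (rule integral_combine[OF int0]) (use that in auto)
  have F_HK: "F t = integral {0..t} \<psi>" if "t \<le> 1" for t
    unfolding F_def by (rule lebesgue_integral_eq_integral[OF int0[OF that]]) simp
  have "continuous_on {0..1} (\<lambda>t. integral {0..t} \<psi>)"
    by (rule indefinite_integral_continuous_1) (use integrable_on_lebesgue_on[OF int] in simp)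
  then have cont: "continuous_on {0..1} F"
    by (rule continuous_on_cong[THEN iffD1, rotated 2]) (auto simp: F_HK)
  have grid: "F (real i / 2 ^ n) \<le> F (real j / 2 ^ n)" if "i \<le> j" "j \<le> 2 ^ n" for i j n
    using that
  proof (induction j rule: dec_induct)
    case (step m)
    have m: "m < 2 ^ n" using step.prems by simp
    have "real m + 1 \<le> 2 ^ n" by (rule real_Suc_le_pow[OF m])
    then have "F ((real m + 1) / 2 ^ n) = F (real m / 2 ^ n) + integral\<^sup>L (lebesgue_on (dyadic_ivl n m)) \<psi>"
      unfolding dyadic_ivl_def by (intro Fdiff) (auto simp: divide_right_mono)
    with cells[OF m] step show ?case by (simp add: add.commute)
  qed simp
  \<comment> \<open>The largest dyadic point of generation \<open>n\<close> below \<open>x\<close>.\<close>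
  define r where "r = (\<lambda>(x::real) n. real (nat \<lfloor>x * 2 ^ n\<rfloor>) / 2 ^ n)"
  have r: "r x n \<le> x" "0 \<le> r x n" "x - (1/2) ^ n \<le> r x n" if "0 \<le> x" for x :: real and n
  proof -
    have "real (nat \<lfloor>x * 2 ^ n\<rfloor>) = of_int \<lfloor>x * 2 ^ n\<rfloor>" using that by simp
    moreover have "of_int \<lfloor>x * 2 ^ n\<rfloor> \<le> x * 2 ^ n" "x * 2 ^ n - 1 \<le> of_int \<lfloor>x * 2 ^ n\<rfloor>"
      by linarith+
    ultimately have "r x n \<le> x * 2 ^ n / 2 ^ n" "(x * 2 ^ n - 1) / 2 ^ n \<le> r x n"
      unfolding r_def by (simp_all only: divide_right_mono zero_le_power zero_le_numeral)
    then show "r x n \<le> x" "x - (1/2) ^ n \<le> r x n"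
      by (simp_all add: diff_divide_distrib power_one_over)
    show "0 \<le> r x n" by (simp add: r_def)
  qed
  have rlim: "(\<lambda>n. r x n) \<longlonglongrightarrow> x" if "0 \<le> x" for x
  proof (rule tendsto_sandwich)
    show "(\<lambda>n. x - (1/2) ^ n) \<longlonglongrightarrow> x"
      by (rule tendsto_eq_intros LIMSEQ_power_zero refl | simp)+
    show "(\<lambda>n. x) \<longlonglongrightarrow> x" by simp
  qed (use r[OF that] in auto)
  have Flim: "(\<lambda>n. F (r x n)) \<longlonglongrightarrow> F x" if "0 \<le> x" "x \<le> 1" for x
    by (rule continuous_on_tendsto_compose[OF cont rlim[OF that(1)]])
      (use that r[OF that(1)] order_trans[OF r(1)[OF that(1)] that(2)] in \<open>auto intro!: always_eventually\<close>)
  have "F a \<le> F b"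
  proof (rule LIMSEQ_le[OF Flim Flim])
    have "F (r a n) \<le> F (r b n)" for n
      unfolding r_def
    proof (rule grid)
      show "nat \<lfloor>a * 2 ^ n\<rfloor> \<le> nat \<lfloor>b * 2 ^ n\<rfloor>" using ab by (intro nat_mono floor_mono mult_right_mono) auto
      have "b * 2 ^ n \<le> 2 ^ n" using ab mult_right_mono[of b 1 "2 ^ n"] by simp
      then have "\<lfloor>b * 2 ^ n\<rfloor> \<le> \<lfloor>(2 ^ n :: real)\<rfloor>" by (rule floor_mono)
      also have "\<lfloor>(2 ^ n :: real)\<rfloor> = 2 ^ n" by (metis floor_of_int of_int_numeral of_int_power)
      finally show "nat \<lfloor>b * 2 ^ n\<rfloor> \<le> 2 ^ n" by (simp add: nat_le_iff)
    qed
    then show "\<exists>N. \<forall>n\<ge>N. F (r a n) \<le> F (r b n)" by blast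
  qed (use ab in auto)
  then show ?thesis using Fdiff[OF ab] by simp
qed

text \<open>A transcription of the library's differentiation theorem for gauge integrals to the restricted
  Lebesgue measure, applied to the extension of \<open>h\<close> by zero; the right end point is discarded.\<close>

lemma one_sided_Lebesgue_differentiation:
  fixes h :: "real \<Rightarrow> 'a::euclidean_space"
  assumes int: "integrable (lebesgue_on {0..1}) h"
  shows "AE x in lebesgue_on {0..1}.
    ((\<lambda>t. (1 / t) *\<^sub>R integral\<^sup>L (lebesgue_on {x..x + t}) h) \<longlongrightarrow> h x) (at_right 0)"
proof -
  \<comment> \<open>The library theorem wants local integrability on the whole line.\<close>
  define h0 where "h0 = (\<lambda>x. if x \<in> {0..1} then h x else 0)"
  have "h integrable_on {0..1}" by (rule integrable_on_lebesgue_on[OF int]) simp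
  then have "h0 integrable_on UNIV" unfolding h0_def by (simp only: integrable_restrict_UNIV)
  then have h0: "h0 integrable_on cbox a b" for a b by (rule integrable_on_subcbox) simp
  obtain N where N: "negligible N" and lim: "\<And>x e. \<lbrakk>x \<notin> N; 0 < e\<rbrakk> \<Longrightarrow>
      \<exists>d>0. \<forall>t. 0 < t \<and> t < d \<longrightarrow> norm (integral (cbox x (x + t *\<^sub>R One)) h0 /\<^sub>R t ^ DIM(real) - h0 x) < e"
    using integrable_ccontinuous_explicit[of h0, OF h0] by blast
  have "negligible (N \<union> {1})" using N by simp
  then have "AE x in lebesgue. x \<notin> N \<union> {1}"
    by (intro AE_not_in) (simp only: negligible_iff_null_sets)
  then have "AE x in lebesgue. x \<in> {0..1} \<longrightarrow> ((\<lambda>t. (1 / t) *\<^sub>R integral\<^sup>L (lebesgue_on {x..x + t}) h) \<longlongrightarrow> h x) (at_right 0)"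
  proof (rule eventually_mono, intro impI)
    fix x :: real assume x: "x \<notin> N \<union> {1}" "x \<in> {0..1}"
    show "((\<lambda>t. (1 / t) *\<^sub>R integral\<^sup>L (lebesgue_on {x..x + t}) h) \<longlongrightarrow> h x) (at_right 0)"
      unfolding tendsto_iff
    proof (intro allI impI)
      fix e :: real assume "0 < e"
      with lim[of x e] x obtain d where d: "0 < d"
        "\<And>t. 0 < t \<Longrightarrow> t < d \<Longrightarrow> norm (integral (cbox x (x + t *\<^sub>R One)) h0 /\<^sub>R t ^ DIM(real) - h0 x) < e" by blast
      have "dist ((1 / t) *\<^sub>R integral\<^sup>L (lebesgue_on {x..x + t}) h) (h x) < e" if t: "0 < t" "t < min d (1 - x)" for t
      proof -
        have sub: "{x..x + t} \<subseteq> {0..1}" using x t by auto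
        have "integral (cbox x (x + t *\<^sub>R One)) h0 = integral {x..x + t} h"
          using sub by (auto simp: h0_def intro!: Henstock_Kurzweil_Integration.integral_cong)
        also have "\<dots> = integral\<^sup>L (lebesgue_on {x..x + t}) h"
          by (rule lebesgue_integral_eq_integral[symmetric, OF integrable_subinterval[OF int sub]]) simp
        finally show ?thesis
          using d(2)[of t] t x by (simp add: h0_def dist_norm divide_inverse)
      qed
      moreover have "0 < min d (1 - x)" using d x by auto
      ultimately show "\<forall>\<^sub>F t in at_right 0. dist ((1 / t) *\<^sub>R integral\<^sup>L (lebesgue_on {x..x + t}) h) (h x) < e"
        unfolding eventually_at_right_field by blast
    qed
  qed
  then show ?thesis by (simp add: AE_restrict_space_iff)
qed

lemma continuous_onorm: "continuous_on UNIV (\<lambda>A::complex^'n^'n. onorm ((*v) A))"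
proof (rule continuous_onI)
  have lip: "onorm ((*v) A) \<le> onorm ((*v) B) + norm (A - B)" for A B :: "complex^'n^'n"
  proof -
    have "onorm ((*v) A) = onorm (\<lambda>x. B *v x + (A - B) *v x)" by (simp add: mv_sub)
    also have "\<dots> \<le> onorm ((*v) B) + onorm ((*v) (A - B))" by (rule onorm_triangle[OF bounded_linear_mv bounded_linear_mv])
    also have "onorm ((*v) (A - B)) \<le> norm (A - B)" by (rule onorm_bound[OF norm_ge_zero norm_mv])
    finally show ?thesis by simp
  qed
  fix A :: "complex^'n^'n" and e :: real assume "0 < e"
  have "dist (onorm ((*v) B)) (onorm ((*v) A)) \<le> e" if "dist B A < e" for B :: "complex^'n^'n"
    using lip[of A B] lip[of B A] that by (simp add: dist_norm norm_minus_commute)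
  with \<open>0 < e\<close> show "\<exists>d>0. \<forall>x'\<in>UNIV. dist x' A < d \<longrightarrow> dist (onorm ((*v) x')) (onorm ((*v) A)) \<le> e" by blast
qed

text \<open>Taking suprema one factor at a time.\<close>

lemma onorm_product_bound:
  fixes A B :: "complex^'n^'n"
  assumes c: "0 \<le> c" and le: "\<And>y z. norm (A *v y) * norm (B *v z) \<le> c * norm y * norm z"
  shows "onorm ((*v) A) * onorm ((*v) B) \<le> c"
proof -
  have 1: "norm (A *v y) * onorm ((*v) B) \<le> c * norm y" for y
  proof (cases "norm (A *v y) = 0")
    case False
    then have pos: "0 < norm (A *v y)" by simp
    have "onorm ((*v) B) \<le> c * norm y / norm (A *v y)"
      by (rule onorm_bound) (use le[of y] pos c in \<open>auto simp: field_simps\<close>)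
    then show ?thesis using pos by (simp add: field_simps)
  qed (use c in simp)
  show ?thesis
  proof (cases "onorm ((*v) B) = 0")
    case False
    then have pos: "0 < onorm ((*v) B)" using onorm_pos_le[OF bounded_linear_mv[of B]] by simp
    have "onorm ((*v) A) \<le> c / onorm ((*v) B)"
      by (rule onorm_bound) (use 1 pos c in \<open>auto simp: field_simps\<close>)
    then show ?thesis using pos by (simp add: field_simps)
  qed (use c in simp)
qed

text \<open>The test on a single interval is not additive in the interval, but the arithmetic--geometric mean
  inequality with a parameter \<open>s\<close> linearises its right-hand side. The linear inequality passes from
  dyadic to arbitrary intervals and then, almost everywhere, to the point values of \<open>W\<close> and \<open>W\<^sup>-\<^sup>1\<close>,
  with one exceptional set for all vectors and all \<open>s\<close>. Optimising \<open>s\<close> after the substitution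
  \<open>u = W\<^sup>-\<^sup>1 z\<close>, \<open>v = W y\<close> bounds the product of the norms of \<open>W y\<close> and \<open>W\<^sup>-\<^sup>1 z\<close>.\<close>

theorem cond_number_finite:
  fixes W :: "real \<Rightarrow> complex^'n^'n"
  assumes W: "matrix_weight W" and c: "0 \<le> c"
    and hyp: "\<And>f g A. f \<in> L2 \<Longrightarrow> g \<in> L2 \<Longrightarrow> carleson 1 A \<Longrightarrow> bilinear_sum A W f g \<le> ennreal (c * L2_norm f * L2_norm g)"
  shows "cond_number W \<le> ennreal (c\<^sup>2)"
proof -
  note WD = matrix_weightD[OF W]
  let ?V = "\<lambda>x. matrix_inv (W x)"
  let ?avg = "\<lambda>h x t. (1 / t) *\<^sub>R integral\<^sup>L (lebesgue_on {x..x + t :: real}) h :: complex^'n^'n"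
  have interval: "norm u * norm v \<le> c / 2 * (s * (u \<bullet> (?avg W x t *v u)) + 1 / s * (v \<bullet> (?avg ?V x t *v v)))"
    if s: "0 < s" and x: "0 \<le> x" "0 < t" "x + t \<le> 1" for u v s x t
  proof -
    define \<psi> where "\<psi> = (\<lambda>x. c / 2 * (s * (u \<bullet> (W x *v u)) + 1 / s * (v \<bullet> (?V x *v v))) - norm u * norm v)"
    have intg: "integrable (lebesgue_on {a..b}) \<psi> \<and> integral\<^sup>L (lebesgue_on {a..b}) \<psi> =
       c / 2 * (s * (u \<bullet> (integral\<^sup>L (lebesgue_on {a..b}) W *v u)) + 1 / s * (v \<bullet> (integral\<^sup>L (lebesgue_on {a..b}) ?V *v v)))
        - (b - a) * (norm u * norm v)" if ab: "0 \<le> a" "a \<le> b" "b \<le> 1" for a b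
    proof -
      have iW: "integrable (lebesgue_on {a..b}) W" by (rule integrable_subinterval[OF WD(2)]) (use ab in auto)
      have iV: "integrable (lebesgue_on {a..b}) ?V" by (rule integrable_subinterval[OF WD(3)]) (use ab in auto)
      have i1: "integrable (lebesgue_on {a..b}) (\<lambda>x. s * (u \<bullet> (W x *v u)))"
        by (intro integrable_mult_right integral_inner_mv(2)[OF iW])
      have i2: "integrable (lebesgue_on {a..b}) (\<lambda>x. 1 / s * (v \<bullet> (?V x *v v)))"
        by (intro integrable_mult_right integral_inner_mv(2)[OF iV])
      have i3: "integrable (lebesgue_on {a..b}) (\<lambda>x. c / 2 * (s * (u \<bullet> (W x *v u)) + 1 / s * (v \<bullet> (?V x *v v))))"
        by (intro integrable_mult_right Bochner_Integration.integrable_add i1 i2)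
      have i4: "integrable (lebesgue_on {a..b}) (\<lambda>x. norm u * norm v)"
        by (rule finite_measure.integrable_const) (simp add: finite_measure_lebesgue_on)
      have c4: "integral\<^sup>L (lebesgue_on {a..b}) (\<lambda>x. norm u * norm v) = (b - a) * (norm u * norm v)"
        using ab by (simp add: measure_restrict_space)
      show ?thesis
      proof
        show "integrable (lebesgue_on {a..b}) \<psi>" unfolding \<psi>_def by (intro Bochner_Integration.integrable_diff i3 i4)
        have "integral\<^sup>L (lebesgue_on {a..b}) \<psi> = integral\<^sup>L (lebesgue_on {a..b}) (\<lambda>x. c / 2 * (s * (u \<bullet> (W x *v u)) + 1 / s * (v \<bullet> (?V x *v v)))) - (b - a) * (norm u * norm v)"
          unfolding \<psi>_def Bochner_Integration.integral_diff[OF i3 i4] c4 ..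
        also have "integral\<^sup>L (lebesgue_on {a..b}) (\<lambda>x. c / 2 * (s * (u \<bullet> (W x *v u)) + 1 / s * (v \<bullet> (?V x *v v)))) =
          c / 2 * (integral\<^sup>L (lebesgue_on {a..b}) (\<lambda>x. s * (u \<bullet> (W x *v u))) + integral\<^sup>L (lebesgue_on {a..b}) (\<lambda>x. 1 / s * (v \<bullet> (?V x *v v))))"
          unfolding integral_mult_right_zero Bochner_Integration.integral_add[OF i1 i2] ..
        also have "\<dots> = c / 2 * (s * (u \<bullet> (integral\<^sup>L (lebesgue_on {a..b}) W *v u)) + 1 / s * (v \<bullet> (integral\<^sup>L (lebesgue_on {a..b}) ?V *v v)))"
          unfolding integral_mult_right_zero integral_inner_mv(1)[OF iW] integral_inner_mv(1)[OF iV] ..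
        finally show "integral\<^sup>L (lebesgue_on {a..b}) \<psi> =
       c / 2 * (s * (u \<bullet> (integral\<^sup>L (lebesgue_on {a..b}) W *v u)) + 1 / s * (v \<bullet> (integral\<^sup>L (lebesgue_on {a..b}) ?V *v v)))
        - (b - a) * (norm u * norm v)" .
      qed
    qed
    have "0 \<le> integral\<^sup>L (lebesgue_on {x..x + t}) \<psi>"
    proof (rule integral_interval_nonneg)
      show "integrable (lebesgue_on {0..1}) \<psi>" using intg[of 0 1] by simp
      fix n k :: nat assume k: "k < 2 ^ n"
      let ?a = "u \<bullet> (integral\<^sup>L (lebesgue_on (dyadic_ivl n k)) W *v u)" and ?b = "v \<bullet> (integral\<^sup>L (lebesgue_on (dyadic_ivl n k)) ?V *v v)"
      have psdint: "psd (integral\<^sup>L (lebesgue_on (dyadic_ivl n k)) W')" if "matrix_weight W'" for W' :: "real \<Rightarrow> complex^'n^'n"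
        by (rule psd_integral[OF integrable_dyadic_ivl[OF matrix_weightD(2)[OF that] k]],
            rule eventually_mono[OF AE_dyadic_ivl[OF matrix_weightD(1)[OF that] k]]) simp
      have ab: "0 \<le> ?a" "0 \<le> ?b" using psdint[OF W] psdint[OF matrix_weight_inv[OF W]] psd_nonneg by blast+
      have "norm u * norm v / 2 ^ n \<le> c * (sqrt ?a * sqrt ?b)"
        using single_interval_test[OF W k c hyp, of u v] by (simp add: mult.assoc)
      also have "\<dots> \<le> c * ((s * ?a + 1 / s * ?b) / 2)"
      proof (rule mult_left_mono[OF _ c])
        have "0 \<le> (sqrt (s * ?a) - sqrt (1 / s * ?b))\<^sup>2" by simp
        also have "\<dots> = s * ?a + 1 / s * ?b - 2 * (sqrt (s * ?a) * sqrt (1 / s * ?b))"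
          using s ab by (simp add: power2_diff)
        also have "sqrt (s * ?a) * sqrt (1 / s * ?b) = sqrt ?a * sqrt ?b"
          using s by (simp add: real_sqrt_mult real_sqrt_divide)
        finally show "sqrt ?a * sqrt ?b \<le> (s * ?a + 1 / s * ?b) / 2" by simp
      qed
      finally have *: "norm u * norm v / 2 ^ n \<le> c / 2 * (s * ?a + 1 / s * ?b)" by simp
      have "real k + 1 \<le> 2 ^ n" by (rule real_Suc_le_pow[OF k])
      then have "integral\<^sup>L (lebesgue_on (dyadic_ivl n k)) \<psi> = c / 2 * (s * ?a + 1 / s * ?b) - ((real k + 1) / 2 ^ n - real k / 2 ^ n) * (norm u * norm v)"
        using intg[of "real k / 2 ^ n" "(real k + 1) / 2 ^ n"] unfolding dyadic_ivl_def by (simp add: divide_right_mono)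
      also have "(real k + 1) / 2 ^ n - real k / 2 ^ n = 1 / 2 ^ n" by (simp add: diff_divide_distrib[symmetric])
      finally show "0 \<le> integral\<^sup>L (lebesgue_on (dyadic_ivl n k)) \<psi>" using * by simp
    qed (use x in auto)
    also have "\<dots> = c / 2 * (s * (u \<bullet> (integral\<^sup>L (lebesgue_on {x..x+t}) W *v u)) + 1 / s * (v \<bullet> (integral\<^sup>L (lebesgue_on {x..x+t}) ?V *v v)))
        - t * (norm u * norm v)"
      using intg[of x "x + t"] x by simp
    finally have "t * (norm u * norm v) \<le> c / 2 * (s * (u \<bullet> (integral\<^sup>L (lebesgue_on {x..x+t}) W *v u)) + 1 / s * (v \<bullet> (integral\<^sup>L (lebesgue_on {x..x+t}) ?V *v v)))" by simp
    then have "(1 / t) * (t * (norm u * norm v)) \<le> (1 / t) * (c / 2 * (s * (u \<bullet> (integral\<^sup>L (lebesgue_on {x..x+t}) W *v u)) + 1 / s * (v \<bullet> (integral\<^sup>L (lebesgue_on {x..x+t}) ?V *v v))))"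
      using x by (intro mult_left_mono) auto
    then show ?thesis using x by (simp add: mv_scaleR algebra_simps)
  qed
  have "AE x in lebesgue. x \<notin> {1::real}"
    by (intro AE_not_in) (simp flip: negligible_iff_null_sets)
  then have "AE x in lebesgue. x \<in> {0..1} \<longrightarrow> x \<in> {0..<1::real}"
    by (rule eventually_mono) auto
  then have "AE x in lebesgue_on {0..1}. x \<in> {0..<1::real}"
    by (simp add: AE_restrict_space_iff)
  then have "AE x in lebesgue_on {0..1}. onorm ((*v) (W x)) * onorm ((*v) (?V x)) \<le> c\<^sup>2"
    using WD(1) one_sided_Lebesgue_differentiation[OF WD(2)] one_sided_Lebesgue_differentiation[OF WD(3)]
  proof eventually_elim
    fix x assume x: "x \<in> {0..<1}" and psd: "psd (W x) \<and> invertible (W x)"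
      and limW: "(?avg W x \<longlongrightarrow> W x) (at_right 0)" and limV: "(?avg ?V x \<longlongrightarrow> ?V x) (at_right 0)"
    have pt: "norm u * norm v \<le> c / 2 * (s * (u \<bullet> (W x *v u)) + 1 / s * (v \<bullet> (?V x *v v)))" if s: "0 < s" for u v s
    proof (rule tendsto_lowerbound)
      show "((\<lambda>t. c / 2 * (s * (u \<bullet> (?avg W x t *v u)) + 1 / s * (v \<bullet> (?avg ?V x t *v v)))) \<longlongrightarrow>
        c / 2 * (s * (u \<bullet> (W x *v u)) + 1 / s * (v \<bullet> (?V x *v v)))) (at_right 0)"
        by (intro tendsto_mult tendsto_add tendsto_inner tendsto_const bounded_bilinear.tendsto[OF bounded_bilinear_mv] limW limV)
      show "\<forall>\<^sub>F t in at_right 0. norm u * norm v \<le> c / 2 * (s * (u \<bullet> (?avg W x t *v u)) + 1 / s * (v \<bullet> (?avg ?V x t *v v)))"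
      proof -
        have "norm u * norm v \<le> c / 2 * (s * (u \<bullet> (?avg W x t *v u)) + 1 / s * (v \<bullet> (?avg ?V x t *v v)))"
          if "0 < t" "t < 1 - x" for t
          by (rule interval[OF s]) (use x that in auto)
        moreover have "0 < 1 - x" using x by simp
        ultimately show ?thesis unfolding eventually_at_right_field by blast
      qed
    qed simp
    have Vp: "psd (?V x)" and inv: "invertible (W x)" using psd psd_matrix_inv by blast+
    have "norm (W x *v y) * norm (?V x *v z) \<le> c\<^sup>2 * norm y * norm z" for y z
    proof -
      let ?P = "norm (W x *v y)" and ?Q = "norm (?V x *v z)"
      have "?Q * ?P \<le> 2 * sqrt (c / 2 * (?Q * norm z)) * sqrt (c / 2 * (?P * norm y))"
      proof (rule le_two_sqrt)
        fix s :: real assume s: "0 < s"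
        have "(?V x *v z) \<bullet> (W x *v (?V x *v z)) \<le> ?Q * norm z"
          using norm_cauchy_schwarz[of "?V x *v z" z] by (simp add: matrix_inv_cancel[OF inv] del: matrix_vector_mul_assoc)
        moreover have "(W x *v y) \<bullet> (?V x *v (W x *v y)) \<le> ?P * norm y"
          using norm_cauchy_schwarz[of "W x *v y" y] by (simp add: matrix_inv_cancel[OF inv] del: matrix_vector_mul_assoc)
        ultimately have "c / 2 * (s * ((?V x *v z) \<bullet> (W x *v (?V x *v z))) + 1 / s * ((W x *v y) \<bullet> (?V x *v (W x *v y))))
          \<le> c / 2 * (s * (?Q * norm z) + 1 / s * (?P * norm y))"
          using s c by (intro mult_left_mono add_mono) auto
        with pt[OF s, of "?V x *v z" "W x *v y"]
        show "?Q * ?P \<le> s * (c / 2 * (?Q * norm z)) + c / 2 * (?P * norm y) / s"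
          by (simp add: algebra_simps)
      qed (use c in auto)
      also have "\<dots> = c * (sqrt (?Q * ?P) * sqrt (norm y * norm z))"
        using c by (simp add: real_sqrt_mult real_sqrt_divide)
      finally have 1: "?Q * ?P \<le> c * (sqrt (?Q * ?P) * sqrt (norm y * norm z))" .
      have "sqrt (?Q * ?P) \<le> c * sqrt (norm y * norm z)"
      proof (cases "?Q * ?P = 0")
        case False
        then have pos: "0 < sqrt (?Q * ?P)" by (simp add: less_le)
        have "sqrt (?Q * ?P) * sqrt (?Q * ?P) \<le> sqrt (?Q * ?P) * (c * sqrt (norm y * norm z))"
          using 1 by (simp add: mult_ac)
        then show ?thesis using pos by (simp only: mult_le_cancel_left_pos)
      qed (use c in auto)
      then have "(sqrt (?Q * ?P))\<^sup>2 \<le> (c * sqrt (norm y * norm z))\<^sup>2" by (rule power_mono) simp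
      then show ?thesis by (simp add: power_mult_distrib mult_ac)
    qed
    then show "onorm ((*v) (W x)) * onorm ((*v) (?V x)) \<le> c\<^sup>2" by (intro onorm_product_bound) auto
  qed
  then have AEc: "AE x in lebesgue_on {0..1}. ennreal (onorm ((*v) (W x)) * onorm ((*v) (?V x))) \<le> ennreal (c\<^sup>2)"
    by (rule eventually_mono) (rule ennreal_leI)
  have o: "(\<lambda>A::complex^'n^'n. onorm ((*v) A)) \<in> borel_measurable borel"
    by (rule borel_measurable_continuous_onI[OF continuous_onorm])
  have "(\<lambda>x. onorm ((*v) (W x)) * onorm ((*v) (?V x))) \<in> borel_measurable (lebesgue_on {0..1})"
    using WD(2,3) by (intro borel_measurable_times measurable_compose[OF _ o]) auto
  then show ?thesis
    unfolding cond_number_def using AEc by (intro esssup_I) auto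
qed

section \<open>Optimality of the exponent\<close>

definition diag :: "('n \<Rightarrow> real) \<Rightarrow> complex^'n^'n" where
  "diag d = (\<chi> i j. if i = j then of_real (d i) else 0)"

lemma diag_mv: "(diag d *v x) $ i = d i *\<^sub>R x $ i"
  by (simp add: diag_def matrix_vector_mult_def if_distrib[of "\<lambda>a. a * _"] scaleR_conv_of_real cong: if_cong)

lemma diag_inner: "x \<bullet> (diag d *v x) = (\<Sum>i\<in>UNIV. d i * (norm (x $ i))\<^sup>2)"
  by (simp add: inner_vec_def diag_mv power2_norm_eq_inner)

lemma psd_diag: "(\<And>i. 0 \<le> d i) \<Longrightarrow> psd (diag d)"
  unfolding psd_iff_inner diag_inner by (auto simp: hermitian_def diag_def intro!: sum_nonneg)

lemma diag_inverse:
  fixes d :: "'n::finite \<Rightarrow> real"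
  assumes "\<And>i. 0 < d i"
  shows "invertible (diag d)" "matrix_inv (diag d) = diag (\<lambda>i. 1 / d i)"
proof -
  have nz: "d i \<noteq> 0" for i using assms[of i] by simp
  have 1: "diag d ** diag (\<lambda>i. 1 / d i) = mat 1" "diag (\<lambda>i. 1 / d i) ** diag d = mat 1"
    by (rule mat_eqI; simp add: vec_eq_iff diag_mv nz flip: matrix_vector_mul_assoc)+
  show inv: "invertible (diag d)" unfolding invertible_def using 1 by blast
  show "matrix_inv (diag d) = diag (\<lambda>i. 1 / d i)"
    by (metis 1(1) inv matrix_inv_mult(2) matrix_mul_assoc matrix_mul_lid matrix_mul_rid)
qed

lemma onorm_diag_le:
  fixes d :: "'n::finite \<Rightarrow> real"
  assumes "\<And>i. 0 \<le> d i" "\<And>i. d i \<le> m"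
  shows "onorm ((*v) (diag d)) \<le> m"
proof (rule onorm_bound)
  show m: "0 \<le> m" using assms order_trans by blast
  fix x :: "complex^'n"
  have "norm (diag d *v x) = L2_set (\<lambda>i. d i * norm (x $ i)) UNIV"
    using assms by (simp add: norm_vec_def diag_mv)
  also have "\<dots> \<le> L2_set (\<lambda>i. m * norm (x $ i)) UNIV"
    using assms by (intro L2_set_mono mult_right_mono) auto
  also have "\<dots> = m * norm x" using m by (simp add: norm_vec_def L2_set_right_distrib)
  finally show "norm (diag d *v x) \<le> m * norm x" .
qed

lemma onorm_inverse_ge_1:
  fixes A :: "complex^'n^'n"
  assumes "invertible A"
  shows "1 \<le> onorm ((*v) A) * onorm ((*v) (matrix_inv A))"
proof -
  let ?e = "axis undefined 1 :: complex^'n"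
  have "1 = norm (A *v (matrix_inv A *v ?e))"
    by (simp add: matrix_inv_cancel[OF assms] norm_axis_complex del: matrix_vector_mul_assoc)
  also have "\<dots> \<le> onorm ((*v) A) * norm (matrix_inv A *v ?e)" by (rule onorm[OF bounded_linear_mv])
  also have "\<dots> \<le> onorm ((*v) A) * (onorm ((*v) (matrix_inv A)) * norm ?e)"
    by (intro mult_left_mono onorm onorm_pos_le bounded_linear_mv)
  finally show ?thesis by (simp add: norm_axis_complex)
qed

lemma cond_number_const:
  fixes A :: "complex^'n^'n"
  shows "cond_number (\<lambda>x. A) = ennreal (onorm ((*v) A) * onorm ((*v) (matrix_inv A)))"
  unfolding cond_number_def by (rule esssup_const) (simp add: emeasure_restrict_space)

lemma matrix_weight_const:
  fixes A :: "complex^'n^'n"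
  assumes "psd A" "invertible A"
  shows "matrix_weight (\<lambda>x. A)"
proof -
  have "finite_measure (lebesgue_on {0..1::real})" by (simp add: finite_measure_lebesgue_on)
  then show ?thesis using assms by (simp add: matrix_weight_def finite_measure.integrable_const)
qed

text \<open>For the constant weight \<open>diag (\<kappa>, 1, \<dots>, 1)\<close>, take for \<open>u\<close> an axis with eigenvalue \<open>1\<close> of \<open>W\<close> and for
  \<open>v\<close> the axis with eigenvalue \<open>1 / \<kappa>\<close> of \<open>W\<^sup>-\<^sup>1\<close>. The test on the unit interval then reads
  \<open>1 \<le> c \<kappa>\<^sup>p \<kappa>\<^sup>-\<^sup>1\<^sup>/\<^sup>2\<close>, which fails for large \<open>\<kappa>\<close>.\<close>

theorem exponent_lower_bound:
  fixes a b :: "'n::finite" and c p :: real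
  assumes ab: "a \<noteq> b" and p: "p < 1/2" 
    and hyp: "\<And>(W :: real \<Rightarrow> complex^'n^'n) f g A. matrix_weight W \<Longrightarrow> cond_number W < \<infinity> \<Longrightarrow> f \<in> L2 \<Longrightarrow> g \<in> L2 \<Longrightarrow>
      carleson 1 A \<Longrightarrow> bilinear_sum A W f g \<le> ennreal (c * enn2real (cond_number W) powr p * L2_norm f * L2_norm g)"
  shows False
proof -
  \<comment> \<open>A negative exponent is replaced by zero, since the condition number is at least one.\<close>
  define q where "q = max p 0"
  define c' where "c' = max c 0"
  have sqrt_le: "sqrt \<kappa> \<le> c' * \<kappa> powr q" if \<kappa>: "1 \<le> \<kappa>" for \<kappa> :: real
  proof -
    define d where "d = (\<lambda>i. if i = a then \<kappa> else 1)"
    define W where "W = (\<lambda>x::real. diag d)"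
    have dpos: "0 < d i" "1 / d i \<le> 1" "0 \<le> d i" "d i \<le> \<kappa>" for i using \<kappa> by (auto simp: d_def)
    have inv: "invertible (diag d)" and minv: "matrix_inv (diag d) = diag (\<lambda>i. 1 / d i)"
      using diag_inverse[of d] dpos by auto
    have W: "matrix_weight W" unfolding W_def using dpos by (intro matrix_weight_const inv psd_diag) auto
    define k where "k = onorm ((*v) (diag d)) * onorm ((*v) (matrix_inv (diag d)))"
    have k1: "1 \<le> k" unfolding k_def by (rule onorm_inverse_ge_1[OF inv])
    have "k \<le> \<kappa> * 1"
      unfolding k_def minv using dpos \<kappa> by (intro mult_mono onorm_diag_le onorm_pos_le bounded_linear_mv) auto
    then have k2: "k \<le> \<kappa>" by simp
    have cW: "cond_number W = ennreal k" unfolding W_def k_def by (rule cond_number_const)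
    have "k powr p \<le> k powr q" using k1 by (intro powr_mono) (auto simp: q_def)
    also have "\<dots> \<le> \<kappa> powr q" using k1 k2 by (intro powr_mono2) (auto simp: q_def)
    finally have kq: "c * k powr p \<le> c' * \<kappa> powr q" by (intro mult_mono) (auto simp: c'_def)
    have est: "bilinear_sum A W f g \<le> ennreal (c' * \<kappa> powr q * L2_norm f * L2_norm g)"
      if "f \<in> L2" "g \<in> L2" "carleson 1 A" for f g and A :: "real set \<Rightarrow> complex^'n^'n"
    proof -
      have "bilinear_sum A W f g \<le> ennreal (c * enn2real (cond_number W) powr p * L2_norm f * L2_norm g)"
        by (rule hyp[OF W _ that]) (simp add: cW)
      also have "\<dots> \<le> ennreal (c' * \<kappa> powr q * L2_norm f * L2_norm g)"
        using kq k1 by (intro ennreal_leI mult_right_mono) (auto simp: cW L2_norm_def)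
      finally show ?thesis .
    qed
    have int: "integral\<^sup>L (lebesgue_on (dyadic_ivl 0 0)) (\<lambda>x. B) = B" for B :: "complex^'n^'n"
      by (simp add: dyadic_ivl_0 measure_restrict_space)
    have ax: "(\<Sum>i\<in>UNIV. e i * (norm (axis j (1::complex) $ i))\<^sup>2) = e j" for j and e :: "'n \<Rightarrow> real"
      by (simp add: axis_def if_distrib[of norm] if_distrib[of "\<lambda>t. t\<^sup>2"] if_distrib[of "\<lambda>t. _ * t"] cong: if_cong)
    have "0 \<le> c' * \<kappa> powr q" by (simp add: c'_def)
    from single_interval_test[OF W _ this est, of 0 0 "axis b 1" "axis a 1"]
    have "1 \<le> c' * \<kappa> powr q * sqrt (axis b 1 \<bullet> (diag d *v axis b 1)) * sqrt (axis a 1 \<bullet> (diag (\<lambda>i. 1 / d i) *v axis a 1))"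
      unfolding W_def minv int by (simp add: norm_axis_complex)
    also have "\<dots> = c' * \<kappa> powr q * sqrt (1 / \<kappa>)"
      unfolding diag_inner ax using ab by (simp add: d_def)
    finally show ?thesis using \<kappa> by (simp add: real_sqrt_divide field_simps)
  qed
  define r where "r = 1/2 - q"
  have r: "0 < r" using p by (auto simp: r_def q_def)
  \<comment> \<open>Chosen such that \<open>\<kappa> powr r = c' + 1\<close>.\<close>
  define \<kappa> where "\<kappa> = (c' + 1) powr (1 / r)"
  have \<kappa>: "1 \<le> \<kappa>" unfolding \<kappa>_def using r by (intro ge_one_powr_ge_zero) (auto simp: c'_def)
  have "\<kappa> powr r * \<kappa> powr q = sqrt \<kappa>"
    using \<kappa> by (simp add: r_def powr_add[symmetric] powr_half_sqrt)
  also have "\<dots> \<le> c' * \<kappa> powr q" by (rule sqrt_le[OF \<kappa>])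
  finally have "\<kappa> powr r \<le> c'" using \<kappa> by simp
  moreover have "\<kappa> powr r = c' + 1"
    using r by (simp add: \<kappa>_def powr_powr c'_def)
  ultimately show False by simp
qed

theorem theorem3p7:
  "(\<forall>C\<^sub>0>0. \<exists>C\<ge>0. \<forall>(A :: real set \<Rightarrow> complex^'n^'n) W.
      matrix_weight W \<longrightarrow> carleson C\<^sub>0 A \<longrightarrow> cond_number W < \<infinity> \<longrightarrow>
      (\<forall>f\<in>L2. \<forall>g\<in>L2. bilinear_sum A W f g \<le>
         ennreal (C * enn2real (cond_number W) powr (1/2) * L2_norm f * L2_norm g)))
   \<and>
   (\<forall>W :: real \<Rightarrow> complex^'n^'n. matrix_weight W \<longrightarrow>
      (\<exists>C'. \<forall>f\<in>L2. \<forall>g\<in>L2. \<forall>A. carleson 1 A \<longrightarrow>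
         bilinear_sum A W f g \<le> ennreal (C' * L2_norm f * L2_norm g)) \<longrightarrow>
      cond_number W < \<infinity>)
   \<and>
   (CARD('n) \<ge> 2 \<longrightarrow>
      (\<forall>p<1/2. \<not> (\<exists>C''. \<forall>(W :: real \<Rightarrow> complex^'n^'n). matrix_weight W \<longrightarrow> cond_number W < \<infinity> \<longrightarrow>
         (\<forall>f\<in>L2. \<forall>g\<in>L2. \<forall>A. carleson 1 A \<longrightarrow>
            bilinear_sum A W f g \<le>
              ennreal (C'' * enn2real (cond_number W) powr p * L2_norm f * L2_norm g)))))"
proof (intro conjI allI impI)
  fix C\<^sub>0 :: real assume C: "C\<^sub>0 > 0"
  show "\<exists>C\<ge>0. \<forall>(A :: real set \<Rightarrow> complex^'n^'n) W.
      matrix_weight W \<longrightarrow> carleson C\<^sub>0 A \<longrightarrow> cond_number W < \<infinity> \<longrightarrow>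
      (\<forall>f\<in>L2. \<forall>g\<in>L2. bilinear_sum A W f g \<le>
         ennreal (C * enn2real (cond_number W) powr (1/2) * L2_norm f * L2_norm g))"
    using C by (intro exI[of _ "4 * real CARD('n) ^ 3 * C\<^sub>0"] conjI allI impI ballI bilinear_embedding) auto
next
  fix W :: "real \<Rightarrow> complex^'n^'n"
  assume W: "matrix_weight W"
    and "\<exists>C'. \<forall>f\<in>L2. \<forall>g\<in>L2. \<forall>A. carleson 1 A \<longrightarrow> bilinear_sum A W f g \<le> ennreal (C' * L2_norm f * L2_norm g)"
  then obtain c where c: "\<And>f g A. f \<in> L2 \<Longrightarrow> g \<in> L2 \<Longrightarrow> carleson 1 A \<Longrightarrow>
      bilinear_sum A W f g \<le> ennreal (c * L2_norm f * L2_norm g)" by blast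
  \<comment> \<open>The given constant may be negative.\<close>
  have "cond_number W \<le> ennreal ((max c 0)\<^sup>2)"
  proof (rule cond_number_finite[OF W])
    fix f g :: "real \<Rightarrow> complex^'n" and A :: "real set \<Rightarrow> complex^'n^'n"
    assume "f \<in> L2" "g \<in> L2" "carleson 1 A"
    then have "bilinear_sum A W f g \<le> ennreal (c * L2_norm f * L2_norm g)" by (rule c)
    also have "\<dots> \<le> ennreal (max c 0 * L2_norm f * L2_norm g)"
      by (intro ennreal_leI mult_right_mono) (auto simp: L2_norm_def)
    finally show "bilinear_sum A W f g \<le> ennreal (max c 0 * L2_norm f * L2_norm g)" .
  qed simp
  also have "\<dots> < \<infinity>" by simp
  finally show "cond_number W < \<infinity>" .
next
  fix p :: real assume p: "p < 1/2" and "CARD('n) \<ge> 2"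
  then have "card (UNIV :: 'n set) \<noteq> 0 \<and> card (UNIV :: 'n set) \<noteq> 1" by simp
  then obtain a b :: 'n where ab: "a \<noteq> b"
    by (metis UNIV_I card_1_singleton_iff is_singletonI' is_singleton_altdef UNIV_not_empty)
  show "\<not> (\<exists>C''. \<forall>(W :: real \<Rightarrow> complex^'n^'n). matrix_weight W \<longrightarrow> cond_number W < \<infinity> \<longrightarrow>
         (\<forall>f\<in>L2. \<forall>g\<in>L2. \<forall>A. carleson 1 A \<longrightarrow>
            bilinear_sum A W f g \<le>
              ennreal (C'' * enn2real (cond_number W) powr p * L2_norm f * L2_norm g)))"
    using exponent_lower_bound[OF ab p] by blast
qed

end
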